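(* Let $p_1,p_2$ and $q_1,q_2$ be pairs of distinct nonisotropic nonorthogonal points of $\mathbb PV$ with $\sigma p_i=\sigma q_i$, and let $\alpha_i,\beta_i\in\mathbb S^1\setminus\Omega$ be parameters with $\alpha_i\sim\beta_i$, $i=1,2$. Assume that the complex lines $\mathrm L(p_1,p_2)$ and $\mathrm L(q_1,q_2)$ are noneuclidean and not orthogonal to each other. Then a length $4$ relation $R_{\alpha_2}^{p_2}R_{\alpha_1}^{p_1}=R_{\beta_2}^{q_2}R_{\beta_1}^{q_1}$ follows from bending and $f$-bending relations. (That is, there is a finite sequence of quadruples from $(p_1,p_2;\alpha_1,\alpha_2)$ to $(q_1,q_2;\beta_1,\beta_2)$ such that the equality between the products given by any two consecutive quadruples is a bending relation or an $f$-bending relation.)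
   Context: Let $V$ be a 3-dimensional complex vector space with a Hermitian form $\langle-,-\rangle$ (linear in the first argument) of signature $++-$. The same letter denotes a point of $\mathbb PV$ and a representative. A point $p$ has signature $\sigma p\in\{-1,0,1\}$, the sign of $\langle p,p\rangle$ (nonisotropic means $\sigma p\neq0$). $\mathrm{SU}(2,1)$ is the group of determinant $1$ linear automorphisms of $V$ preserving the form; fixed points of its elements are points of $\mathbb PV$ given by eigenvectors. $\mathbb S^1\subset\mathbb C$ is the unit circle, $\omega=e^{2\pi i/3}$, $\Omega=\{1,\omega,\omega^2\}$; a parameter is an element of $\mathbb S^1\setminus\Omega$. For nonisotropic $p$ and $\alpha\in\mathbb S^1$, $R_\alpha^p:x\mapsto(\alpha^{-2}-\alpha)\frac{\langle x,p\rangle}{\langle p,p\rangle}p+\alpha x$. $\mathrm L(p_1,p_2)$ is the complex projective line through $p_1\ne p_2$; a line $\mathbb PW$ is noneuclidean if the form on $W$ is nondegenerate; its polar point is $\mathbb PW^\perp$; two lines are orthogonal if the polar point of one lies on the other. Geodesics. Let $L$ be a noneuclidean complex line. A geodesic in $L$ is the image in $\mathbb PV$ of $U\setminus\{0\}$, where $U$ is a real $2$-dimensional subspace on which the form is real and not identically zero, when this image lies in $L$. Through distinct nonorthogonal $p,q\in L$ there is a unique geodesic (given by $U=\mathbb Rp+\mathbb R\langle p,q\rangle q$). For nonorthogonal nonisotropic $p,q\in L$ of the same signature, $\mathrm G[p,q]$ is the arc of the geodesic through $p,q$ that joins $p$ and $q$ and does not contain the point of $L$ orthogonal to $p$ ($\mathrm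 G[p,p]=\{p\}$). For geodesics $G_1,G_2\subset L$ meeting at a nonisotropic $p$, $\angle_pG_1G_2\in[0,\pi)$ is the counterclockwise oriented angle from $G_1$ to $G_2$ at $p$ (orientation of $L$ given by its complex structure). $\mathrm{Arg}$ takes values in $[0,2\pi)$. $J=\{e^{i\theta}:0<\theta<\pi/3\}$; the primitive of a parameter $\alpha$ is the unique $a\in J$ with $a^6=\alpha^3$. With $I_0=\{e^{i\theta}:0<\theta<2\pi/3\}$, $I_1=\omega I_0$, $I_2=\omega^2I_0$, $\alpha\sim\beta$ means that $\alpha,\beta$ lie in the same $I_j$. For distinct nonisotropic nonorthogonal $p_1,p_2$ with $L=\mathrm L(p_1,p_2)$ noneuclidean and parameters $\alpha_1,\alpha_2$ with primitives $a_1,a_2$, the geodesics associated to $R_{\alpha_2}^{p_2}R_{\alpha_1}^{p_1}$ are $G,G_1,G_2\subset L$, where $G$ passes through $p_1,p_2$, $G_i$ passes through $p_i$, $\angle_{p_1}G_1G=\mathrm{Arg}(a_1^3)$, $\angle_{p_2}GG_2=\mathrm{Arg}(a_2^3)$. Quadruples $(p_1,p_2;\alpha_1,\alpha_2)$ consist of two distinct nonisotropic nonorthogonal points spanning a noneuclidean line and two parameters, and give the product $R_{\alpha_2}^{p_2}R_{\alpha_1}^{p_1}$. A bending relation is $R_{\alpha_2}^{p_2}R_{\alpha_1}^{p_1}=R_{\alpha_2}^{Cp_2}R_{\alpha_1}^{Cp_1}$ with $C\in\mathrm{SU}(2,1)$ commuting with $R_{\alpha_2}^{p_2}R_{\alpha_1}^{p_1}$.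 An $f$-bending relation is a relation $R_{\alpha_2}^{p_2}R_{\alpha_1}^{p_1}=R_{\beta_2}^{q_2}R_{\beta_1}^{q_1}$ such that, with $G,G_1,G_2$ the geodesics associated to $R:=R_{\alpha_2}^{p_2}R_{\alpha_1}^{p_1}$: $q_i\in G_i$, $\sigma q_i=\sigma p_i$, $\langle p_i,q_i\rangle\neq0$, $\alpha_i\sim\beta_i$ ($i=1,2$), $\alpha_1\alpha_2=\beta_1\beta_2$, and neither $\mathrm G[p_1,q_1]$ nor $\mathrm G[p_2,q_2]$ contains a fixed point of $R$. *)

theory Defs
  imports "HOL-Analysis.Analysis"
begin

section \<open>Hermitian forms and the projective plane\<close>

text \<open>
  The ambient space is \<open>complex^3\<close> with an arbitrary Hermitian form \<open>h\<close> of signature ++-.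
  Throughout, \<open>*s\<close>, \<open>vec.span\<close> are the operations over the complex numbers, while \<open>span\<close>,
  \<open>subspace\<close>, \<open>dim\<close> and \<open>closed_segment\<close> are those of the underlying real vector space.
\<close>

type_synonym cvec = "complex^3"
type_synonym cform = "cvec \<Rightarrow> cvec \<Rightarrow> complex"

definition hermitian_form :: "cform \<Rightarrow> bool" where
  "hermitian_form h \<longleftrightarrow>
     (\<forall>x y z. h (x + y) z = h x z + h y z) \<and>
     (\<forall>c x y. h (c *s x) y = c * h x y) \<and>
     (\<forall>x y. h y x = cnj (h x y))"

definition signature_ppm :: "cform \<Rightarrow> bool" where
  "signature_ppm h \<longleftrightarrow>
     (\<exists>b1 b2 b3. vec.span {b1, b2, b3} = UNIV \<and>
        h b1 b2 = 0 \<and> h b1 b3 = 0 \<and> h b2 b3 = 0 \<and>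
        Re (h b1 b1) > 0 \<and> Re (h b2 b2) > 0 \<and> Re (h b3 b3) < 0)"

text \<open>
  A point of the projective plane is a one-dimensional complex subspace.  Named points
  such as \<open>p\<close> and \<open>q\<close> are given by nonzero representatives, as \<open>point p\<close>; all notions
  below depend on the representatives only through the points.
\<close>

definition point :: "cvec \<Rightarrow> cvec set" where
  "point v = vec.span {v}"

definition projective :: "cvec set \<Rightarrow> cvec set set" where
  "projective W = point ` (W - {0})"

definition sgn_point :: "cform \<Rightarrow> cvec \<Rightarrow> real" where
  "sgn_point h p = sgn (Re (h p p))"

text \<open>The complex line \<open>L(p,q)\<close> is \<open>projective (line_space p q)\<close>.\<close>

definition line_space :: "cvec \<Rightarrow> cvec \<Rightarrow> cvec set" where
  "line_space p q = vec.span {p, q}"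

definition noneuclidean :: "cform \<Rightarrow> cvec set \<Rightarrow> bool" where
  "noneuclidean h W \<longleftrightarrow> (\<forall>x\<in>W. (\<forall>y\<in>W. h x y = 0) \<longrightarrow> x = 0)"

text \<open>For \<open>W\<close> of dimension 2 the set below is a one-dimensional subspace, that is, a point.\<close>

definition polar :: "cform \<Rightarrow> cvec set \<Rightarrow> cvec set" where
  "polar h W = {x. \<forall>w\<in>W. h x w = 0}"

definition orthogonal_lines :: "cform \<Rightarrow> cvec set \<Rightarrow> cvec set \<Rightarrow> bool" where
  "orthogonal_lines h W W' \<longleftrightarrow> polar h W \<in> projective W' \<or> polar h W' \<in> projective W"

definition SU21 :: "cform \<Rightarrow> (complex^3^3) set" where
  "SU21 h = {C. det C = 1 \<and> (\<forall>x y. h (C *v x) (C *v y) = h x y)}"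

definition fixed_points :: "(cvec \<Rightarrow> cvec) \<Rightarrow> cvec set set" where
  "fixed_points R = {point v | v. v \<noteq> 0 \<and> (\<exists>\<mu>. R v = \<mu> *s v)}"


section \<open>Parameters and reflections\<close>

definition omega :: complex where
  "omega = cis (2 * pi / 3)"

definition parameters :: "complex set" where
  "parameters = {\<alpha>. norm \<alpha> = 1} - {1, omega, omega\<^sup>2}"

definition primitive :: "complex \<Rightarrow> complex" where
  "primitive \<alpha> = (THE a. a \<in> {cis t | t. 0 < t \<and> t < pi / 3} \<and> a ^ 6 = \<alpha> ^ 3)"

definition same_sector :: "complex \<Rightarrow> complex \<Rightarrow> bool" where
  "same_sector \<alpha> \<beta> \<longleftrightarrow>
     (\<exists>j<3::nat. {\<alpha>, \<beta>} \<subseteq> (\<lambda>z. omega ^ j * z) ` {cis t | t. 0 < t \<and> t < 2 * pi / 3})"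

definition refl_map :: "cform \<Rightarrow> complex \<Rightarrow> cvec \<Rightarrow> cvec \<Rightarrow> cvec" where
  "refl_map h \<alpha> p x = ((1 / \<alpha>\<^sup>2 - \<alpha>) * (h x p / h p p)) *s p + \<alpha> *s x"


section \<open>Geodesics, arcs and angles\<close>

definition geodesic :: "cform \<Rightarrow> cvec set set \<Rightarrow> cvec set set \<Rightarrow> bool" where
  "geodesic h L G \<longleftrightarrow>
     (\<exists>U. subspace U \<and> dim U = 2 \<and> (\<forall>x\<in>U. \<forall>y\<in>U. h x y \<in> \<real>) \<and> (\<exists>x\<in>U. \<exists>y\<in>U. h x y \<noteq> 0) \<and>
          G = projective U \<and> G \<subseteq> L)"

text \<open>
  For nonorthogonal \<open>p\<close>, \<open>q\<close> representing distinct points, the geodesic through them is the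
  projectivization of the real plane spanned by \<open>p\<close> and \<open>\<langle>p,q\<rangle>q\<close>.  The points represented by
  \<open>p\<close> and \<open>\<langle>p,q\<rangle>q\<close> cut this real projective line into two arcs, the images of the segments
  from \<open>p\<close> to \<open>\<langle>p,q\<rangle>q\<close> and from \<open>p\<close> to \<open>-\<langle>p,q\<rangle>q\<close>; exactly one of them contains no
  point orthogonal to \<open>p\<close>.
\<close>

definition geod_arc :: "cform \<Rightarrow> cvec \<Rightarrow> cvec \<Rightarrow> cvec set set" where
  "geod_arc h p q =
     (if point p = point q then {point p}
      else THE A. A \<in> {point ` closed_segment p (h p q *s q), point ` closed_segment p (- (h p q *s q))} \<and>
                  (\<forall>x. x \<noteq> 0 \<and> point x \<in> A \<longrightarrow> h x p \<noteq> 0))"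

text \<open>
  The tangent space at \<open>p\<close> of a complex line, the projectivization of \<open>W\<close>, is the complex
  vector space of linear maps from the span of \<open>p\<close> to its quotient in \<open>W\<close>.  If a geodesic
  is the projectivization of the real span of \<open>p\<close> and \<open>u\<close>, then the curve \<open>t \<mapsto> p + t u\<close>
  lies on it and has velocity \<open>p \<mapsto> u mod p\<close> at \<open>t = 0\<close>.  Hence the first geodesic is
  rotated into the second one by the counterclockwise angle \<open>\<theta>\<close> iff the tangent vectors
  given by \<open>u1\<close>, \<open>u2\<close> can be chosen such that \<open>u2\<close> equals \<open>cis \<theta> *s u1\<close> modulo \<open>p\<close>.
\<close>

definition geod_angle :: "cvec \<Rightarrow> cvec set set \<Rightarrow> cvec set set \<Rightarrow> real" where
  "geod_angle p G1 G2 =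
     (THE \<theta>. 0 \<le> \<theta> \<and> \<theta> < pi \<and>
        (\<exists>u1 u2 c. G1 = projective (span {p, u1}) \<and> G2 = projective (span {p, u2}) \<and>
                   u2 = cis \<theta> *s u1 + c *s p))"


section \<open>Quadruples, bending and f-bending\<close>

type_synonym quadruple = "cvec \<times> cvec \<times> complex \<times> complex"

fun valid_quadruple :: "cform \<Rightarrow> quadruple \<Rightarrow> bool" where
  "valid_quadruple h (p1, p2, \<alpha>1, \<alpha>2) \<longleftrightarrow>
     point p1 \<noteq> point p2 \<and> sgn_point h p1 \<noteq> 0 \<and> sgn_point h p2 \<noteq> 0 \<and> h p1 p2 \<noteq> 0 \<and>
     noneuclidean h (line_space p1 p2) \<and> \<alpha>1 \<in> parameters \<and> \<alpha>2 \<in> parameters"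

fun refl_product :: "cform \<Rightarrow> quadruple \<Rightarrow> cvec \<Rightarrow> cvec" where
  "refl_product h (p1, p2, \<alpha>1, \<alpha>2) = refl_map h \<alpha>2 p2 \<circ> refl_map h \<alpha>1 p1"

fun associated_geodesics ::
  "cform \<Rightarrow> quadruple \<Rightarrow> cvec set set \<Rightarrow> cvec set set \<Rightarrow> cvec set set \<Rightarrow> bool" where
  "associated_geodesics h (p1, p2, \<alpha>1, \<alpha>2) G G1 G2 \<longleftrightarrow>
     (let L = projective (line_space p1 p2) in
        geodesic h L G \<and> geodesic h L G1 \<and> geodesic h L G2 \<and>
        point p1 \<in> G \<and> point p2 \<in> G \<and> point p1 \<in> G1 \<and> point p2 \<in> G2 \<and>
        geod_angle p1 G1 G = Arg2pi (primitive \<alpha>1 ^ 3) \<and>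
        geod_angle p2 G G2 = Arg2pi (primitive \<alpha>2 ^ 3))"

fun bending_relation :: "cform \<Rightarrow> quadruple \<Rightarrow> quadruple \<Rightarrow> bool" where
  "bending_relation h (p1, p2, \<alpha>1, \<alpha>2) (q1, q2, \<beta>1, \<beta>2) \<longleftrightarrow>
     (let R = refl_product h (p1, p2, \<alpha>1, \<alpha>2) in
        R = refl_product h (q1, q2, \<beta>1, \<beta>2) \<and> \<beta>1 = \<alpha>1 \<and> \<beta>2 = \<alpha>2 \<and>
        (\<exists>C\<in>SU21 h. (*v) C \<circ> R = R \<circ> (*v) C \<and>
           point q1 = point (C *v p1) \<and> point q2 = point (C *v p2)))"

fun f_bending_relation :: "cform \<Rightarrow> quadruple \<Rightarrow> quadruple \<Rightarrow> bool" where
  "f_bending_relation h (p1, p2, \<alpha>1, \<alpha>2) (q1, q2, \<beta>1, \<beta>2) \<longleftrightarrow>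
     (let R = refl_product h (p1, p2, \<alpha>1, \<alpha>2) in
        R = refl_product h (q1, q2, \<beta>1, \<beta>2) \<and>
        (\<exists>G G1 G2. associated_geodesics h (p1, p2, \<alpha>1, \<alpha>2) G G1 G2 \<and>
           point q1 \<in> G1 \<and> point q2 \<in> G2) \<and>
        sgn_point h q1 = sgn_point h p1 \<and> sgn_point h q2 = sgn_point h p2 \<and>
        h p1 q1 \<noteq> 0 \<and> h p2 q2 \<noteq> 0 \<and>
        same_sector \<alpha>1 \<beta>1 \<and> same_sector \<alpha>2 \<beta>2 \<and> \<alpha>1 * \<alpha>2 = \<beta>1 * \<beta>2 \<and>
        geod_arc h p1 q1 \<inter> fixed_points R = {} \<and>
        geod_arc h p2 q2 \<inter> fixed_points R = {})"

definition relation_step :: "cform \<Rightarrow> quadruple \<Rightarrow> quadruple \<Rightarrow> bool" where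
  "relation_step h Q Q' \<longleftrightarrow>
     valid_quadruple h Q \<and> valid_quadruple h Q' \<and>
     (bending_relation h Q Q' \<or> f_bending_relation h Q Q')"

end

theory Submission
  imports Defs
begin

text \<open>
  Let \<open>S\<close> be the product of the two reflections, rescaled to have determinant one on the plane
  \<open>W\<close> spanned by \<open>p1\<close>, \<open>p2\<close>, and let \<open>K\<close> be half of its trace there.  Then
  \<open>Z = \<i> (S - K)\<close> is self-adjoint on \<open>W\<close> with \<open>Z\<^sup>2 = N = 1 - K\<^sup>2\<close>, and the geodesics \<open>G1\<close>, \<open>G2\<close>
  are spanned over the reals by \<open>p1\<close>, \<open>Z p1\<close> and by \<open>p2\<close>, \<open>Z p2\<close>.  So f-bending moves
  \<open>p1\<close>, \<open>p2\<close> by operators \<open>1 + b Z\<close> with real \<open>b\<close>, and \<open>N b\<^sup>2 < 1\<close> keeps the arcs away from the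
  fixed points, while bending by isometries \<open>a + b Z\<close> with complex \<open>a\<close>, \<open>b\<close> covers the centralizer.

  The polar points of the two lines are nonorthogonal eigenvectors with a simple eigenvalue, so the
  lines coincide and both quadruples have the same \<open>W\<close>, \<open>S\<close> and \<open>Z\<close>.  Up to the centralizer, a point
  \<open>x\<close> of given sign is determined by \<open>\<langle>Zx,x\<rangle>/\<langle>x,x\<rangle>\<close>; a single f-bending gives \<open>p1\<close> the value that
  belongs to \<open>q1\<close>, and then a single bending reaches \<open>(q1, q2)\<close>.
\<close>

section \<open>Hermitian forms and reflections\<close>

text \<open>On \<open>W\<close> the rescaled product has determinant one, so Cayley-Hamilton reads S
  + S^-1 = 2K. As S^-1 is the adjoint of S, the operator \<open>Z\<close> = \<i> (S - S^-1)/2 is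
  self-adjoint there. All computations take place in the commutative algebra of operators a + bZ
  with Z^2 = N and multiplicative norm a^2 - N b^2, which treats elliptic (N > 0), parabolic (N = 0)
  and loxodromic (N < 0) products at once. The difficulty is sign control: the operators 1 + bZ must
  have positive norm and preserve the signs of both points, and one such operator has to carry
  \<open>p1\<close> into the centralizer orbit of \<open>q1\<close>. The equality of products after
  the f-bending is never computed from its definition. The new points are preimages of
  \<open>q1\<close>, \<open>q2\<close> under an isometry C commuting with S, so their reflections
  are conjugates of those at \<open>q1\<close>, \<open>q2\<close>. It remains to see that the
  preimage of \<open>q2\<close> also has the form p2 + bZ p2. The relation \<sim> fixes the cube
  root of unity hidden in each parameter. Parameters thereby become angles in (0, pi), and equal
  eigenvalues give equal angle sums.\<close>

locale hermitian =
  fixes h :: cform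
  assumes form: "hermitian_form h"
begin

lemma add_left: "h (x + y) z = h x z + h y z"
  using form unfolding hermitian_form_def by blast

lemma scale_left: "h (c *s x) y = c * h x y"
  using form unfolding hermitian_form_def by blast

lemma conj_sym: "h y x = cnj (h x y)"
  using form unfolding hermitian_form_def by blast

lemma add_right: "h z (x + y) = h z x + h z y"
  by (metis add_left conj_sym complex_cnj_add)

lemma scale_right: "h x (c *s y) = cnj c * h x y"
  by (metis scale_left conj_sym complex_cnj_mult)

lemma zero_left [simp]: "h 0 y = 0"
  using scale_left[of 0 0 y] by simp

lemma zero_right [simp]: "h y 0 = 0"
  using scale_right[of y 0 0] by simp

lemma diff_left: "h (x - y) z = h x z - h y z"
  using add_left[of "x - y" y z] by (simp add: algebra_simps)

lemma diff_right: "h z (x - y) = h z x - h z y"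
  using add_right[of z "x - y" y] by (simp add: algebra_simps)

lemma minus_left: "h (- x) y = - h x y"
  using diff_left[of 0 x y] by simp

lemma minus_right: "h y (- x) = - h y x"
  using diff_right[of y 0 x] by simp

lemmas expand = add_left scale_left add_right scale_right diff_left diff_right minus_left minus_right

lemma norm_real: "h x x = of_real (Re (h x x))"
proof -
  have "Im (h x x) = Im (cnj (h x x))" by (subst conj_sym) (rule refl)
  then show ?thesis by (simp add: complex_eq_iff)
qed

lemma orthogonal_sym: "h x y = 0 \<Longrightarrow> h y x = 0"
  by (subst conj_sym) simp

lemma Re_norm_nz: "h x x \<noteq> 0 \<Longrightarrow> Re (h x x) \<noteq> 0"
  by (subst (asm) norm_real) simp

lemma norm_scale: "h (c *s x) (c *s x) = of_real ((cmod c)\<^sup>2) * h x x"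
  by (simp add: expand of_real_power complex_norm_square mult_ac del: of_real_power)

text \<open>
  \<^term>\<open>refl_map\<close> divided by a unit scalar, so that the determinant becomes one on the planes
  that contain \<open>p\<close>.  Here \<open>cis \<theta>\<close> is the cube of the primitive of the parameter.
\<close>

definition rot :: "real \<Rightarrow> cvec \<Rightarrow> cvec \<Rightarrow> cvec" where
  "rot \<theta> p x = cis \<theta> *s x - (2 * \<i> * sin \<theta> * (h x p / h p p)) *s p"

text \<open>The reflection has eigenvalue \<alpha>^-2 at \<open>p\<close> and \<alpha> on the
  orthogonal complement; \<eta> is the mean of their arguments and \<theta> half the
  difference.\<close>

lemma refl_map_cis:
  assumes "\<alpha> = cis (\<eta> + \<theta>)" and "1 / \<alpha>\<^sup>2 = cis (\<eta> - \<theta>)"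
  shows "refl_map h \<alpha> p x = cis \<eta> *s rot \<theta> p x"
proof -
  have "cis (\<eta> - \<theta>) - cis (\<eta> + \<theta>) = cis \<eta> * (- (2 * \<i> * sin \<theta>))"
    by (simp add: complex_eq_iff cos_add cos_diff sin_add sin_diff algebra_simps)
  then have "1 / \<alpha>\<^sup>2 - \<alpha> = cis \<eta> * (- (2 * \<i> * sin \<theta>))"
    using assms by simp
  then show ?thesis
    unfolding refl_map_def rot_def
    by (simp only: assms(1) cis_mult [symmetric]) (simp add: vec_eq_iff algebra_simps)
qed

lemma rot_add: "rot \<theta> p (x + y) = rot \<theta> p x + rot \<theta> p y"
  by (simp add: rot_def expand vec_eq_iff add_divide_distrib algebra_simps)

lemma rot_scale: "rot \<theta> p (c *s x) = c *s rot \<theta> p x"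
  by (simp add: rot_def expand vec_eq_iff algebra_simps)

lemma rot_self:
  assumes "h p p \<noteq> 0" shows "rot \<theta> p p = cis (- \<theta>) *s p"
proof -
  have "cis \<theta> - 2 * \<i> * sin \<theta> = cis (- \<theta>)"
    by (simp add: complex_eq_iff)
  with assms show ?thesis
    by (simp add: rot_def flip: vec.scale_left_diff_distrib)
qed

lemma rot_orthogonal: "h x p = 0 \<Longrightarrow> rot \<theta> p x = cis \<theta> *s x"
  by (simp add: rot_def)

lemma rot_inverse:
  assumes "h p p \<noteq> 0"
  shows "rot (- \<theta>) p (rot \<theta> p x) = x"
proof -
  define k where "k = h x p / h p p"
  have orth: "h (x - k *s p) p = 0"
    using assms by (simp add: expand k_def)
  have "rot \<theta> p ((x - k *s p) + k *s p) = cis \<theta> *s (x - k *s p) + (k * cis (- \<theta>)) *s p"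
    unfolding rot_add rot_scale rot_self[OF assms] rot_orthogonal[OF orth] by simp
  then have "rot \<theta> p x = cis \<theta> *s (x - k *s p) + (k * cis (- \<theta>)) *s p"
    by simp
  moreover have "rot (- \<theta>) p \<dots> = (cis \<theta> * cis (- \<theta>)) *s (x - k *s p) + (k * cis (- \<theta>) * cis \<theta>) *s p"
    unfolding rot_add rot_scale rot_orthogonal[OF orth] rot_self[OF assms] by simp
  ultimately show ?thesis
    by (simp add: cis_mult mult.assoc)
qed

text \<open>With \<open>rot_inverse\<close> this is unitarity. No condition on \<open>h p p\<close>
  appears, since for isotropic \<open>p\<close> the quotient in \<open>rot\<close> is 0 and
  \<open>rot\<close> is a scalar.\<close>

lemma rot_adjoint: "h (rot \<theta> p x) y = h x (rot (- \<theta>) p y)"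
proof -
  have "cnj (h p p) = h p p" "h p y = cnj (h y p)"
    using conj_sym by metis+
  then show ?thesis
    by (simp add: rot_def expand cis_cnj)
qed

lemma rot_scale_center:
  assumes "c \<noteq> 0" shows "rot \<theta> (c *s p) x = rot \<theta> p x"
proof (cases "h p p = 0")
  case False
  then show ?thesis using assms by (simp add: rot_def expand vec_eq_iff)
qed (simp add: rot_def expand)

lemma rot_unitary:
  assumes "\<And>x y. h (C *v x) (C *v y) = h x y"
  shows "rot \<theta> (C *v p) (C *v x) = C *v rot \<theta> p x"
  by (simp add: rot_def assms matrix_vector_mult_diff_distrib vec.scale matrix_vector_mult_scaleR
      vector_scalar_commute)

end

section \<open>The product of two reflections\<close>

locale config = hermitian +
  fixes p1 p2 :: cvec and \<theta>1 \<theta>2 :: real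
  assumes p1: "h p1 p1 \<noteq> 0" and p2: "h p2 p2 \<noteq> 0" and p12: "h p1 p2 \<noteq> 0"
    and gram: "h p1 p1 * h p2 p2 \<noteq> h p1 p2 * h p2 p1"
    and \<theta>1: "0 < \<theta>1" "\<theta>1 < pi" and \<theta>2: "0 < \<theta>2" "\<theta>2 < pi"
begin

lemma sin1: "sin \<theta>1 > 0" and sin2: "sin \<theta>2 > 0"
  using \<theta>1 \<theta>2 by (simp_all add: sin_gt_zero)

abbreviation W :: "cvec set" where "W \<equiv> vec.span {p1, p2}"

definition S :: "cvec \<Rightarrow> cvec" where "S x = rot \<theta>2 p2 (rot \<theta>1 p1 x)"

definition S' :: "cvec \<Rightarrow> cvec" where "S' x = rot (- \<theta>1) p1 (rot (- \<theta>2) p2 x)"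

text \<open>The tance of the two points: it differs from 0 because they are not orthogonal and from
  1 because \<open>W\<close> is nondegenerate.\<close>

definition \<tau> :: real where "\<tau> = (cmod (h p1 p2))\<^sup>2 / (Re (h p1 p1) * Re (h p2 p2))"

definition K :: real where "K = cos (\<theta>1 - \<theta>2) - 2 * sin \<theta>1 * sin \<theta>2 * \<tau>"

definition Z :: "cvec \<Rightarrow> cvec" where "Z x = \<i> *s (S x - K *s x)"

lemma \<tau>_eq: "of_real \<tau> = h p1 p2 * h p2 p1 / (h p1 p1 * h p2 p2)"
proof -
  have "of_real ((cmod (h p1 p2))\<^sup>2) = h p1 p2 * h p2 p1"
    unfolding conj_sym[of p2 p1] by (rule complex_norm_square)
  then show ?thesis
    unfolding \<tau>_def of_real_divide of_real_mult norm_real[symmetric] by simp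
qed

lemma \<tau>_neq_1: "\<tau> \<noteq> 1"
proof
  assume "\<tau> = 1"
  with \<tau>_eq have "h p1 p2 * h p2 p1 / (h p1 p1 * h p2 p2) = 1" by simp
  with p1 p2 gram show False by simp
qed

lemma \<tau>_neq_0: "\<tau> \<noteq> 0"
proof
  assume "\<tau> = 0"
  then have "h p1 p2 * h p2 p1 / (h p1 p1 * h p2 p2) = 0" using \<tau>_eq by simp
  with p1 p2 p12 conj_sym[of p1 p2] show False by simp
qed

lemma S_add: "S (x + y) = S x + S y" and S_scale: "S (c *s x) = c *s S x"
  and S'_add: "S' (x + y) = S' x + S' y" and S'_scale: "S' (c *s x) = c *s S' x"
  by (simp_all add: S_def S'_def rot_add rot_scale)

lemma S'_S: "S' (S x) = x"
  unfolding S_def S'_def by (simp only: rot_inverse p1 p2 not_False_eq_True)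

lemma S_S': "S (S' x) = x"
  unfolding S_def S'_def
  using rot_inverse[OF p1, of "- \<theta>1"] rot_inverse[OF p2, of "- \<theta>2"] by simp

lemma S_adjoint: "h (S x) y = h x (S' y)"
  by (simp add: S_def S'_def rot_adjoint)

lemma S_p1: "S p1 = cis (- \<theta>1) *s (cis \<theta>2 *s p1 - (2 * \<i> * sin \<theta>2 * (h p1 p2 / h p2 p2)) *s p2)"
  by (simp add: S_def rot_self p1 rot_scale) (simp add: rot_def)

lemma S'_p2: "S' p2 = cis \<theta>2 *s (cis (- \<theta>1) *s p2 + (2 * \<i> * sin \<theta>1 * (h p2 p1 / h p1 p1)) *s p1)"
  by (simp add: S'_def rot_self p2 rot_scale) (simp add: rot_def)

text \<open>Cayley-Hamilton for an operator of determinant one on a plane, checked on a basis: the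
  \<open>p2\<close> components of \<open>S p1\<close> and \<open>S' p1\<close> cancel.\<close>

lemma trace_p1: "S p1 + S' p1 = (2 * K) *s p1"
proof -
  define u where "u = h p1 p2 / h p2 p2"
  define v where "v = h p2 p1 / h p1 p1"
  have uv: "u * v = \<tau>" by (simp add: \<tau>_eq u_def v_def)
  have "rot (- \<theta>2) p2 p1 = cis (- \<theta>2) *s p1 + (2 * \<i> * sin \<theta>2 * u) *s p2"
    by (simp add: rot_def u_def)
  moreover have "rot (- \<theta>1) p1 p2 = cis (- \<theta>1) *s p2 + (2 * \<i> * sin \<theta>1 * v) *s p1"
    by (simp add: rot_def v_def)
  ultimately have S': "S' p1 = cis (- \<theta>2) *s (cis \<theta>1 *s p1)
      + (2 * \<i> * sin \<theta>2 * u) *s (cis (- \<theta>1) *s p2 + (2 * \<i> * sin \<theta>1 * v) *s p1)"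
    by (simp add: S'_def rot_add rot_scale rot_self[OF p1])
  have S: "S p1 = cis (- \<theta>1) *s (cis \<theta>2 *s p1 - (2 * \<i> * sin \<theta>2 * u) *s p2)"
    by (simp add: S_p1 u_def)
  have "S p1 + S' p1 = (cis (- \<theta>1) * cis \<theta>2 + cis (- \<theta>2) * cis \<theta>1 - 4 * sin \<theta>1 * sin \<theta>2 * (u * v)) *s p1"
    unfolding S S' by (simp add: vec_eq_iff algebra_simps)
  also have "cis (- \<theta>1) * cis \<theta>2 + cis (- \<theta>2) * cis \<theta>1 - 4 * sin \<theta>1 * sin \<theta>2 * (u * v) = 2 * K"
    unfolding uv K_def by (simp add: complex_eq_iff cos_diff sin_diff)
  finally show ?thesis .
qed

lemma trace_p2: "S p2 + S' p2 = (2 * K) *s p2"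
proof -
  define u where "u = h p1 p2 / h p2 p2"
  define v where "v = h p2 p1 / h p1 p1"
  have uv: "u * v = \<tau>" by (simp add: \<tau>_eq u_def v_def)
  have "rot \<theta>2 p2 p1 = cis \<theta>2 *s p1 - (2 * \<i> * sin \<theta>2 * u) *s p2"
    by (simp add: rot_def u_def)
  moreover have "rot \<theta>1 p1 p2 = cis \<theta>1 *s p2 + (- (2 * \<i> * sin \<theta>1 * v)) *s p1"
    by (simp add: rot_def v_def)
  ultimately have S: "S p2 = cis \<theta>1 *s (cis (- \<theta>2) *s p2)
      + (- (2 * \<i> * sin \<theta>1 * v)) *s (cis \<theta>2 *s p1 - (2 * \<i> * sin \<theta>2 * u) *s p2)"
    unfolding S_def by (simp only: rot_add rot_scale rot_self[OF p2])
  have S': "S' p2 = cis \<theta>2 *s (cis (- \<theta>1) *s p2 + (2 * \<i> * sin \<theta>1 * v) *s p1)"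
    by (simp add: S'_p2 v_def)
  have "S p2 + S' p2 = (cis (- \<theta>1) * cis \<theta>2 + cis (- \<theta>2) * cis \<theta>1 - 4 * sin \<theta>1 * sin \<theta>2 * (u * v)) *s p2"
    unfolding S S' by (simp add: vec_eq_iff algebra_simps)
  also have "cis (- \<theta>1) * cis \<theta>2 + cis (- \<theta>2) * cis \<theta>1 - 4 * sin \<theta>1 * sin \<theta>2 * (u * v) = 2 * K"
    unfolding uv K_def by (simp add: complex_eq_iff cos_diff sin_diff)
  finally show ?thesis .
qed

lemma W_cases:
  assumes "x \<in> W"
  obtains a b where "x = a *s p1 + b *s p2"
proof -
  from assms obtain a where "x - a *s p1 \<in> vec.span {p2}"
    unfolding vec.span_insert by blast
  then obtain b where "x - a *s p1 = b *s p2"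
    unfolding vec.span_singleton by blast
  then have "x = a *s p1 + b *s p2" by (simp add: algebra_simps)
  then show thesis by (rule that)
qed

lemma in_W: "a *s p1 + b *s p2 \<in> W"
  by (intro vec.span_add vec.span_scale vec.span_base) auto

lemma trace: "x \<in> W \<Longrightarrow> S x + S' x = (2 * K) *s x"
proof (erule W_cases)
  fix a b assume x: "x = a *s p1 + b *s p2"
  have "S x + S' x = a *s (S p1 + S' p1) + b *s (S p2 + S' p2)"
    by (simp add: x S_add S'_add S_scale S'_scale vec_eq_iff algebra_simps)
  then show ?thesis
    unfolding trace_p1 trace_p2 x by (simp add: vec_eq_iff algebra_simps)
qed

lemma Z_add: "Z (x + y) = Z x + Z y" and Z_scale: "Z (c *s x) = c *s Z x"
  by (simp_all add: Z_def S_add S_scale vec_eq_iff algebra_simps)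

text \<open>By \<open>trace\<close>, S - K and S' - K are opposite on \<open>W\<close>. As S' is the
  adjoint of S, this is the source of self-adjointness; it also gives \<open>Z p2\<close>, where S'
  is the simpler of the two.\<close>

lemma Z_alt:
  assumes "x \<in> W" shows "Z x = - \<i> *s (S' x - K *s x)"
proof -
  have S: "S x = (2 * K) *s x - S' x" using trace[OF assms] by (simp add: algebra_simps)
  show ?thesis unfolding Z_def S by (simp add: vec_eq_iff algebra_simps)
qed

text \<open>Modulo \<open>p1\<close> the result is a real multiple of
  \<open>cis (- \<theta>1) * h p1 p2\<close> times \<open>p2\<close>. Its phase is what makes
  \<theta>1 the angle from \<open>G1\<close> to \<open>G\<close>.\<close>

lemma Z_p1: "Z p1 = (\<i> * (cis (\<theta>2 - \<theta>1) - K)) *s p1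
    + (2 * sin \<theta>2 * cis (- \<theta>1) * h p1 p2 / h p2 p2) *s p2"
proof -
  have "cis (\<theta>2 - \<theta>1) = cis (- \<theta>1) * cis \<theta>2" by (simp add: cis_mult)
  then show ?thesis
    unfolding Z_def S_p1 by (simp add: vec_eq_iff algebra_simps)
qed

lemma Z_p2: "Z p2 = (- \<i> * (cis (\<theta>2 - \<theta>1) - K)) *s p2
    + (2 * sin \<theta>1 * cis \<theta>2 * h p2 p1 / h p1 p1) *s p1"
proof -
  have "p2 \<in> W" by (simp add: vec.span_base)
  moreover have "cis (\<theta>2 - \<theta>1) = cis (- \<theta>1) * cis \<theta>2" by (simp add: cis_mult)
  ultimately show ?thesis
    by (simp add: Z_alt S'_p2) (simp add: vec_eq_iff algebra_simps)
qed

lemma Z_in_W: "x \<in> W \<Longrightarrow> Z x \<in> W"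
proof (erule W_cases)
  fix a b assume x: "x = a *s p1 + b *s p2"
  have "Z p1 \<in> W" "Z p2 \<in> W"
    unfolding Z_p1 Z_p2 by (intro vec.span_add vec.span_scale vec.span_base; simp)+
  then show "Z x \<in> W"
    unfolding x Z_add Z_scale by (intro vec.span_add vec.span_scale)
qed

lemma Z_selfadjoint:
  assumes "x \<in> W" "y \<in> W" shows "h (Z x) y = h x (Z y)"
  by (simp add: Z_alt[OF assms(2)]) (simp add: Z_def expand S_adjoint)

lemma Z_Z:
  assumes "x \<in> W" shows "Z (Z x) = (1 - K\<^sup>2) *s x"
proof -
  have "Z (Z x) = - \<i> *s (S' (Z x) - K *s Z x)"
    using Z_alt Z_in_W assms by blast
  also have "S' (Z x) = \<i> *s (x - K *s S' x)"
  proof -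
    have "S' (S x) = S' (S x - K *s x) + K *s S' x"
      by (metis S'_add S'_scale diff_add_cancel)
    then have "S' (S x - K *s x) = x - K *s S' x"
      by (simp add: S'_S algebra_simps)
    then show ?thesis unfolding Z_def S'_scale by simp
  qed
  also have "- \<i> *s (\<i> *s (x - K *s S' x) - K *s Z x) = x - K *s (S x + S' x) + (K * K) *s x"
    unfolding Z_def by (simp add: vec_eq_iff algebra_simps)
  also have "\<dots> = (1 - K\<^sup>2) *s x"
    unfolding trace[OF assms] by (simp add: vec_eq_iff algebra_simps power2_eq_square)
  finally show ?thesis .
qed

end

section \<open>Geodesics, angles and arcs\<close>

lemma scaleR_eq: "r *\<^sub>R (v :: complex^'n) = of_real r *s v"
  by (simp add: vec_eq_iff scaleR_conv_of_real[symmetric])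

lemma mem_cspan1: "x \<in> vec.span {p :: cvec} \<longleftrightarrow> (\<exists>c. x = c *s p)"
  unfolding vec.span_singleton by blast

lemma mem_cspan2: "x \<in> vec.span {p, q :: cvec} \<longleftrightarrow> (\<exists>a b. x = a *s p + b *s q)"
proof
  assume "x \<in> vec.span {p, q}"
  then obtain a where "x - a *s p \<in> vec.span {q}"
    unfolding vec.span_insert by blast
  then obtain b where "x - a *s p = b *s q"
    unfolding vec.span_singleton by blast
  then have "x = a *s p + b *s q" by (simp add: algebra_simps)
  then show "\<exists>a b. x = a *s p + b *s q" by blast
qed (metis insertI1 insertI2 vec.span_add vec.span_scale vec.span_base)

lemma mem_rspan2: "x \<in> span {p, q :: cvec} \<longleftrightarrow> (\<exists>a b. x = of_real a *s p + of_real b *s q)"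
proof
  assume "x \<in> span {p, q}"
  then obtain a where "x - a *\<^sub>R p \<in> span {q}"
    unfolding span_insert by blast
  then obtain b where "x - a *\<^sub>R p = b *\<^sub>R q"
    unfolding span_singleton by blast
  then have "x = of_real a *s p + of_real b *s q" by (simp add: scaleR_eq algebra_simps)
  then show "\<exists>a b. x = of_real a *s p + of_real b *s q" by blast
qed (metis insertI1 insertI2 scaleR_eq span_add span_scale span_base)

lemma cspan_pair_indep:
  assumes "(p :: cvec) \<noteq> 0" "u \<notin> vec.span {p}" "a *s p + b *s u = 0"
  shows "a = 0 \<and> b = 0"
proof -
  have "b = 0"
  proof (rule ccontr)
    assume b: "b \<noteq> 0"
    have "b *s u = - a *s p" using assms(3) by (simp add: eq_neg_iff_add_eq_0 add.commute)
    then have "(1 / b) *s (b *s u) = (1 / b) *s (- a *s p)" by (rule arg_cong)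
    then have "u = (- a / b) *s p" using b by simp
    then show False using assms(2) mem_cspan1 by blast
  qed
  then show ?thesis using assms(1,3) by simp
qed

lemma cspan_pair_unique:
  assumes "(p :: cvec) \<noteq> 0" "u \<notin> vec.span {p}" "a *s p + b *s u = a' *s p + b' *s u"
  shows "a = a' \<and> b = b'"
proof -
  have "(a - a') *s p + (b - b') *s u = 0"
    using assms(3) by (simp add: vec.scale_left_diff_distrib algebra_simps)
  then show ?thesis using cspan_pair_indep[OF assms(1,2)] by fastforce
qed

lemma point_scale: "c \<noteq> 0 \<Longrightarrow> point (c *s v) = point v"
  unfolding point_def by (rule set_eqI) (metis mem_cspan1 vec.scale_scale nonzero_divide_eq_eq)

lemma point_eqD:
  assumes "point u = point v" "u \<noteq> 0"
  obtains c where "c \<noteq> 0" "u = c *s v"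
proof -
  have "u \<in> vec.span {v}" using assms(1) vec.span_base[of u "{u}"] unfolding point_def by simp
  then obtain c where "u = c *s v" using mem_cspan1 by blast
  moreover have "c \<noteq> 0" using assms(2) calculation by auto
  ultimately show thesis using that by blast
qed

lemma projective_scale:
  assumes "c \<noteq> 0" "\<And>x. x \<in> U \<Longrightarrow> c *s x \<in> U'" "\<And>x. x \<in> U' \<Longrightarrow> \<exists>y\<in>U. x = c *s y"
  shows "projective U = projective U'"
proof -
  have "point x \<in> projective U'" if "x \<in> U" "x \<noteq> 0" for x
    using assms(1,2) that point_scale[of c x] unfolding projective_def
    by (metis DiffI imageI singletonD vector_mul_eq_0)
  moreover have "point x \<in> projective U" if "x \<in> U'" "x \<noteq> 0" for x
    using assms(1,3) that point_scale[of c] unfolding projective_def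
    by (metis DiffI imageI singletonD vector_mul_eq_0)
  ultimately show ?thesis unfolding projective_def by blast
qed

lemma in_projective_span:
  assumes "point x \<in> projective (span {p, u})" "x \<noteq> 0"
  shows "\<exists>k a b. x = k *s (of_real a *s p + of_real b *s u)"
proof -
  obtain y where y: "point x = point y" "y \<in> span {p, u}"
    using assms(1) unfolding projective_def by blast
  obtain k where "x = k *s y" using point_eqD[OF y(1) assms(2)] .
  then show ?thesis using y(2) unfolding mem_rspan2 by blast
qed

text \<open>Equality of projectivizations matches vectors only up to a complex factor depending on
  the vector, so reality of the factor \<open>g\<close> needs proof. The points of p + u and p - u
  suffice to force it.\<close>

lemma projective_span_tangent:
  assumes p: "p \<noteq> 0" and u': "u' \<notin> vec.span {p}"
    and eq: "projective (span {p, u}) = projective (span {p, u'})"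
  obtains e g where "g \<noteq> 0" "u = e *s p + of_real g *s u'"
proof -
  have *: "\<exists>k a b. x = k *s (of_real a *s p + of_real b *s u')" if "x \<in> span {p, u}" "x \<noteq> 0" for x
  proof -
    have "point x \<in> projective (span {p, u'})"
      using that unfolding eq[symmetric] unfolding projective_def by (intro imageI DiffI) simp_all
    from in_projective_span[OF this that(2)] show ?thesis .
  qed
  have "u' \<noteq> 0" "u' \<in> span {p, u'}"
    using u' by (auto simp: vec.span_zero span_base)
  then have "point u' \<in> projective (span {p, u})"
    unfolding eq unfolding projective_def by blast
  from in_projective_span[OF this \<open>u' \<noteq> 0\<close>]
  obtain k a b where "u' = k *s (of_real a *s p + of_real b *s u)" by blast
  then have u: "u \<notin> vec.span {p}"
    using u' by (metis vec.span_add vec.span_scale vec.span_base singletonI)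
  then have "u \<noteq> 0" by (auto simp: vec.span_zero)
  then obtain k a b where "u = k *s (of_real a *s p + of_real b *s u')"
    using *[of u] by (auto simp: span_base)
  then have ueq: "u = (k * a) *s p + (k * b) *s u'"
    by (simp add: vec.scale_right_distrib)
  define e where "e = k * a"
  define g where "g = k * b"
  \<comment> \<open>The coefficients of p + s u with respect to \<open>p\<close> and
    \<open>u'\<close> have a real ratio. Subtracting the cases s = 1 and s = -1 eliminates
    \<open>e\<close> and leaves twice the conjugate of \<open>g\<close>.\<close>
  have real: "(1 + s * e) * cnj (s * g) \<in> \<real>" if "s = 1 \<or> s = -1" for s
  proof -
    have "p + s *s u \<noteq> 0"
      using cspan_pair_indep[OF p u, of 1 s] by auto
    moreover have "p + s *s u \<in> span {p, u}"
      unfolding mem_rspan2 by (rule exI[of _ 1], rule exI[of _ "Re s"]) (use that in auto)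
    ultimately obtain k a b where k: "p + s *s u = k *s (of_real a *s p + of_real b *s u')"
      using * by blast
    have "(1 + s * e) *s p + (s * g) *s u' = (k * a) *s p + (k * b) *s u'"
      using k unfolding ueq e_def g_def by (simp add: vec.scale_right_distrib vec.scale_left_distrib add.assoc)
    then have "1 + s * e = k * a" "s * g = k * b"
      using cspan_pair_unique[OF p u'] by blast+
    then have "(1 + s * e) * cnj (s * g) = of_real (a * b * (cmod k)\<^sup>2)"
      by (simp add: complex_norm_square mult_ac del: of_real_power)
    then show ?thesis by (metis Reals_of_real)
  qed
  have "(1 + 1 * e) * cnj (1 * g) - (1 + (-1) * e) * cnj ((-1) * g) \<in> \<real>"
    by (intro Reals_diff real) simp_all
  then have "2 * cnj g \<in> \<real>" by (simp add: algebra_simps)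
  then have "Im g = 0" by (simp add: complex_is_Real_iff)
  then have g: "g = of_real (Re g)" by (simp add: complex_eq_iff)
  moreover have "g \<noteq> 0"
  proof
    assume "g = 0"
    then have "u = e *s p" using ueq e_def g_def by simp
    then show False using u mem_cspan1 by blast
  qed
  ultimately show thesis
    using that[of "Re g" e] ueq e_def g_def by (metis of_real_0)
qed

text \<open>Geodesics are unoriented, so \<open>k\<close> may be negative and the angle counts
  modulo pi: two candidate angles differ by the argument of a real number.\<close>

lemma geod_angle_eq:
  assumes p: "p \<noteq> 0" and v1: "v1 \<notin> vec.span {p}" and k: "k \<noteq> 0"
    and v2: "v2 = cis \<theta> *s (of_real k *s v1) + c *s p" and \<theta>: "0 \<le> \<theta>" "\<theta> < pi"
  shows "geod_angle p (projective (span {p, v1})) (projective (span {p, v2})) = \<theta>"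
  unfolding geod_angle_def
proof (rule the_equality)
  have "span {p, v1} = span {p, of_real k *s v1}"
  proof (intro set_eqI iffI)
    fix x assume "x \<in> span {p, v1}"
    then obtain a b where "x = of_real a *s p + of_real b *s v1" unfolding mem_rspan2 by blast
    then have "x = of_real a *s p + of_real (b / k) *s (of_real k *s v1)" using k by simp
    then show "x \<in> span {p, of_real k *s v1}" unfolding mem_rspan2 by blast
  next
    fix x assume "x \<in> span {p, of_real k *s v1}"
    then obtain a b where "x = of_real a *s p + of_real b *s (of_real k *s v1)" unfolding mem_rspan2 by blast
    then have "x = of_real a *s p + of_real (b * k) *s v1" by simp
    then show "x \<in> span {p, v1}" unfolding mem_rspan2 by blast
  qed
  then show "0 \<le> \<theta> \<and> \<theta> < pi \<and> (\<exists>u1 u2 c. projective (span {p, v1}) = projective (span {p, u1}) \<and>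
      projective (span {p, v2}) = projective (span {p, u2}) \<and> u2 = cis \<theta> *s u1 + c *s p)"
    using \<theta> v2 by metis
next
  fix \<theta>' assume "0 \<le> \<theta>' \<and> \<theta>' < pi \<and> (\<exists>u1 u2 c. projective (span {p, v1}) = projective (span {p, u1}) \<and>
      projective (span {p, v2}) = projective (span {p, u2}) \<and> u2 = cis \<theta>' *s u1 + c *s p)"
  then obtain u1 u2 c' where \<theta>': "0 \<le> \<theta>'" "\<theta>' < pi"
    and u1: "projective (span {p, u1}) = projective (span {p, v1})"
    and u2: "projective (span {p, u2}) = projective (span {p, v2})"
    and u21: "u2 = cis \<theta>' *s u1 + c' *s p" by metis
  have v2': "v2 \<notin> vec.span {p}"
  proof
    assume "v2 \<in> vec.span {p}"
    then obtain d where "v2 = d *s p" unfolding mem_cspan1 by blast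
    then have "(c - d) *s p + (cis \<theta> * k) *s v1 = 0"
      using v2 by (simp add: vec.scale_left_diff_distrib algebra_simps)
    then have "cis \<theta> * k = 0" using cspan_pair_indep[OF p v1] by blast
    then show False using k by simp
  qed
  obtain e1 g1 where g1: "g1 \<noteq> 0" "u1 = e1 *s p + of_real g1 *s v1"
    using projective_span_tangent[OF p v1 u1] by blast
  obtain e2 g2 where g2: "g2 \<noteq> 0" "u2 = e2 *s p + of_real g2 *s v2"
    using projective_span_tangent[OF p v2' u2] by blast
  have "(e2 + g2 * c) *s p + (g2 * cis \<theta> * k) *s v1 = (cis \<theta>' * e1 + c') *s p + (cis \<theta>' * g1) *s v1"
    using u21 unfolding g1(2) g2(2) v2
    by (simp add: vec.scale_right_distrib vec.scale_left_distrib algebra_simps)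
  then have "g2 * cis \<theta> * k = cis \<theta>' * g1"
    using cspan_pair_unique[OF p v1] by blast
  then have "cis (- \<theta>') * (g2 * cis \<theta> * k) = cis (- \<theta>') * (cis \<theta>' * g1)"
    by (rule arg_cong)
  also have "\<dots> = (cis (- \<theta>') * cis \<theta>') * g1" by (simp only: mult.assoc)
  also have "\<dots> = g1" by (simp add: cis_mult)
  also have "cis (- \<theta>') * (g2 * cis \<theta> * k) = of_real (g2 * k) * (cis \<theta> * cis (- \<theta>'))"
    by (simp add: mult_ac)
  finally have "of_real (g2 * k) * cis (\<theta> - \<theta>') = of_real g1"
    by (simp add: cis_mult)
  from arg_cong[OF this, of Im] have "g2 * k * sin (\<theta> - \<theta>') = 0" by simp
  then have "sin (\<theta> - \<theta>') = 0" using k g2(1) by simp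
  from \<theta> \<theta>' have "\<theta> - \<theta>' = 0"
    by (intro sin_eq_0_pi[OF _ _ \<open>sin (\<theta> - \<theta>') = 0\<close>]) linarith+
  then show "\<theta>' = \<theta>" by simp
qed

context hermitian
begin

lemma geodesic_span:
  assumes p: "h p p \<noteq> 0" and u: "u \<notin> vec.span {p}" and real: "h p u \<in> \<real>"
    and W: "vec.subspace V" "p \<in> V" "u \<in> V"
  shows "geodesic h (projective V) (projective (span {p, u}))"
  unfolding geodesic_def
proof (intro exI[of _ "span {p, u}"] conjI ballI)
  have p0: "p \<noteq> 0" using p by auto
  have u0: "u \<notin> span {p}"
  proof
    assume "u \<in> span {p}"
    then obtain r where "u = r *\<^sub>R p" unfolding span_singleton by blast
    then show False using u unfolding mem_cspan1 scaleR_eq by blast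
  qed
  then have "independent {u, p}" "p \<noteq> u"
    using u0 p0 independent_insertI[OF u0] by (auto simp: span_base dependent_single)
  then have "independent {p, u}" "p \<noteq> u" by (simp_all add: insert_commute)
  then show "dim (span {p, u}) = 2"
    by (simp add: dim_eq_card_independent)
  have "h u p = h p u" using real conj_sym[of u p] by (metis Reals_cnj_iff)
  moreover have "h p p \<in> \<real>" "h u u \<in> \<real>" by (metis Reals_of_real norm_real)+
  ultimately show "h x y \<in> \<real>" if "x \<in> span {p, u}" "y \<in> span {p, u}" for x y
    using that real unfolding mem_rspan2 by (auto simp: expand intro!: Reals_add Reals_mult)
  show "\<exists>x\<in>span {p, u}. \<exists>y\<in>span {p, u}. h x y \<noteq> 0"
    using p by (meson span_base insertI1)
  have "span {p, u} \<subseteq> V"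
    using W unfolding mem_rspan2[THEN iffD1] subset_iff
    by (auto simp: mem_rspan2 intro!: vec.subspace_add vec.subspace_scale)
  then show "projective (span {p, u}) \<subseteq> projective V"
    unfolding projective_def by blast
qed auto

text \<open>Along the segment with sign s the product with \<open>p\<close> is the real affine
  function (1 - t) h p p + t s |h p q|^2. It avoids zero when s is the sign of \<open>h p p\<close>
  and vanishes inside the segment otherwise.\<close>

lemma geod_arc_eq:
  assumes p: "h p p \<noteq> 0" and pq: "h p q \<noteq> 0" and neq: "point p \<noteq> point q"
  shows "geod_arc h p q = point ` closed_segment p ((of_real (sgn (Re (h p p))) * h p q) *s q)"
proof -
  define m where "m = Re (h p p)"
  have m: "h p p = of_real m" "m \<noteq> 0" using norm_real p unfolding m_def by (metis, metis of_real_0)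
  define n where "n = (cmod (h p q))\<^sup>2"
  have n: "h q p * h p q = of_real n" "n > 0"
    using pq complex_norm_square[of "h p q"] conj_sym[of p q] by (auto simp: n_def mult.commute)
  define z where "z s t = of_real (1 - t) *s p + of_real t *s ((of_real s * h p q) *s q)" for s t :: real
  define A where "A s = point ` closed_segment p ((of_real s * h p q) *s q)" for s :: real
  have A: "A s = {point (z s t) | t. 0 \<le> t \<and> t \<le> 1}" for s
    unfolding A_def closed_segment_def z_def scaleR_eq by auto
  have hz: "h (z s t) p = of_real ((1 - t) * m + t * s * n)" for s t
    using n(1) by (simp add: z_def expand m) (simp add: algebra_simps)
  have good: "\<forall>x. x \<noteq> 0 \<and> point x \<in> A (sgn m) \<longrightarrow> h x p \<noteq> 0"
  proof (intro allI impI)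
    fix x assume x: "x \<noteq> 0 \<and> point x \<in> A (sgn m)"
    then obtain t where t: "0 \<le> t" "t \<le> 1" "point x = point (z (sgn m) t)" unfolding A by blast
    obtain c where c: "c \<noteq> 0" "x = c *s z (sgn m) t" using point_eqD[OF t(3)] x by blast
    have "sgn m * ((1 - t) * m + t * sgn m * n) = (1 - t) * \<bar>m\<bar> + t * n"
      using m(2) by (auto simp: sgn_if algebra_simps)
    also have "\<dots> > 0"
      using t m(2) n(2) by (cases "t = 0") (auto intro!: add_nonneg_pos)
    finally have "(1 - t) * m + t * sgn m * n \<noteq> 0" by auto
    then show "h x p \<noteq> 0" unfolding c(2) scale_left hz using c(1) by (simp del: of_real_add of_real_mult of_real_diff)
  qed
  have bad: "\<exists>x. x \<noteq> 0 \<and> point x \<in> A (- sgn m) \<and> h x p = 0"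
  proof -
    \<comment> \<open>The zero of that affine function for the wrong sign.\<close>
    define t where "t = \<bar>m\<bar> / (\<bar>m\<bar> + n)"
    have t: "0 \<le> t" "t < 1" using m(2) n(2) by (auto simp: t_def)
    have "(1 - t) * m + t * (- sgn m) * n = 0"
    proof -
      have "1 - t = n / (\<bar>m\<bar> + n)" using m(2) n(2) by (simp add: t_def field_simps)
      moreover have "\<bar>m\<bar> * sgn m = m" by (simp add: abs_mult_sgn)
      ultimately show ?thesis by (simp add: t_def mult.commute)
    qed
    then have "h (z (- sgn m) t) p = 0" unfolding hz by simp
    moreover have "z (- sgn m) t \<noteq> 0"
    proof
      assume "z (- sgn m) t = 0"
      then have eq: "of_real (1 - t) *s p = (of_real t * of_real (sgn m) * h p q) *s q"
        unfolding z_def by (simp add: add_eq_0_iff2)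
      have "p \<noteq> 0" "of_real (1 - t) \<noteq> (0 :: complex)" using t p unfolding of_real_eq_0_iff by auto
      then have "of_real (1 - t) *s p \<noteq> 0" by (metis vector_mul_eq_0)
      then have "of_real t * of_real (sgn m) * h p q \<noteq> 0" unfolding eq by auto
      then have "point p = point q"
        using point_scale[of "of_real (1 - t)" p] point_scale eq t(2) by (metis diff_gt_0_iff_gt less_irrefl of_real_eq_0_iff)
      then show False using neq by simp
    qed
    ultimately show ?thesis using t unfolding A by (metis (mono_tags, lifting) less_imp_le mem_Collect_eq)
  qed
  have sets: "{point ` closed_segment p (h p q *s q), point ` closed_segment p (- (h p q *s q))} = {A (sgn m), A (- sgn m)}"
    using m(2) by (cases "m > 0") (auto simp: A_def)
  have "geod_arc h p q = A (sgn m)"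
    unfolding geod_arc_def sets using neq
    by simp (rule the_equality, use good bad in blast, use good bad in blast)
  then show ?thesis by (simp add: A_def m_def)
qed

text \<open>Here h p q is real with the sign of h p p, so the segment defining the arc ends at a
  positive multiple of q = p + bz. Its points have a positive coefficient at \<open>p\<close> and
  can be normalized to p + l b z.\<close>

lemma geod_arc_subset:
  assumes p: "h p p \<noteq> 0" and real: "h p z \<in> \<real>"
    and pos: "Re (h p p) * Re (h p (p + of_real b *s z)) > 0"
  shows "geod_arc h p (p + of_real b *s z) \<subseteq> {point (p + of_real (l * b) *s z) | l. 0 \<le> l \<and> l \<le> 1}"
proof (cases "point p = point (p + of_real b *s z)")
  case True
  then have "geod_arc h p (p + of_real b *s z) = {point (p + of_real (0 * b) *s z)}" by (simp add: geod_arc_def)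
  then show ?thesis by (auto intro!: exI[of _ 0])
next
  case False
  define q where "q = p + of_real b *s z"
  define k where "k = sgn (Re (h p p)) * Re (h p q)"
  have "h p p \<in> \<real>" by (metis norm_real Reals_of_real)
  then have "h p q \<in> \<real>" using real unfolding q_def expand by (intro Reals_add Reals_mult) auto
  then have hpq: "h p q = of_real (Re (h p q))" by simp
  have k: "k > 0" using pos by (auto simp: k_def sgn_if q_def zero_less_mult_iff)
  have "h p q \<noteq> 0" using pos by (auto simp: q_def)
  note arc = geod_arc_eq[OF p this False[folded q_def]]
  have e: "of_real (sgn (Re (h p p))) * h p q = of_real k" using hpq by (metis k_def of_real_mult)
  show ?thesis unfolding q_def[symmetric] arc e
  proof
    fix P assume "P \<in> point ` closed_segment p (of_real k *s q)"
    then obtain t where t: "0 \<le> t" "t \<le> 1"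
      and P: "P = point (of_real (1 - t) *s p + of_real t *s (of_real k *s q))"
      unfolding closed_segment_def scaleR_eq by auto
    define d where "d = 1 - t + t * k"
    have d: "d > 0" using t k by (cases "t = 1") (auto simp: d_def intro!: add_pos_nonneg)
    define l where "l = t * k / d"
    have l: "0 \<le> l" "l \<le> 1" using d t k by (auto simp: l_def d_def)
    have "of_real (1 - t) *s p + of_real t *s (of_real k *s q) = of_real d *s p + of_real (t * k * b) *s z"
      by (simp add: q_def d_def vec_eq_iff algebra_simps)
    also have "\<dots> = of_real d *s (p + of_real (l * b) *s z)"
      using d by (simp add: l_def vec.scale_right_distrib)
    finally have "P = point (of_real d *s (p + of_real (l * b) *s z))"
      unfolding P by (rule arg_cong)
    also have "\<dots> = point (p + of_real (l * b) *s z)"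
      using d by (intro point_scale) simp
    finally have "P = point (p + of_real (l * b) *s z)" .
    then show "P \<in> {point (p + of_real (l * b) *s z) | l. 0 \<le> l \<and> l \<le> 1}" using l by blast
  qed
qed

end

section \<open>Moving a point along its geodesic\<close>

text \<open>
  With \<open>f = \<langle>Zx,x\<rangle>/\<langle>x,x\<rangle>\<close> the vector \<open>x + b Z x\<close> has square norm
  \<open>(1 + N b\<^sup>2 + 2 b f) \<langle>x,x\<rangle>\<close>, and \<open>g\<close> is the value of the same quotient at \<open>x + b Z x\<close>.
\<close>

lemma torus_step:
  fixes N f g :: real
  assumes same: "(N - f\<^sup>2) * (N - g\<^sup>2) > 0" and pos: "N < f\<^sup>2 \<Longrightarrow> N \<ge> 0 \<Longrightarrow> f * g > 0"
  obtains b where "N * b\<^sup>2 < 1" "1 + N * b\<^sup>2 + 2 * b * f > 0"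
    "(1 + N * b\<^sup>2) * f + 2 * b * N = g * (1 + N * b\<^sup>2 + 2 * b * f)"
proof -
  \<comment> \<open>The operator a + cZ turns the quotient f into (a f + c N)/(a + c f), which
    equals g for a : c = V : U. Since (1 + bZ)^2 = (1 + N b^2) + 2bZ, its ratio must be V : U; the
    norm of V + UZ is w^2.\<close>
  define w where "w = sqrt ((N - f\<^sup>2) * (N - g\<^sup>2))"
  define V where "V = N - f * g"
  define U where "U = g - f"
  have w: "w > 0" "w\<^sup>2 = (N - f\<^sup>2) * (N - g\<^sup>2)" using same by (simp_all add: w_def)
  have VU: "V\<^sup>2 - N * U\<^sup>2 = w\<^sup>2"
    unfolding w(2) V_def U_def by (simp add: power2_eq_square algebra_simps)
  \<comment> \<open>A square root is taken of V + UZ or of its negative; the sign of N - f^2 decides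
    which choice preserves the sign of the point.\<close>
  define d :: real where "d = (if N > f\<^sup>2 then 1 else -1)"
  have d: "d\<^sup>2 = 1" "d * (N - f\<^sup>2) > 0" using same by (auto simp: d_def not_less_iff_gr_or_eq)
  have E: "d * V + w > 0"
  proof (cases "N > f\<^sup>2")
    case True
    then have "N > g\<^sup>2" using same by (simp add: zero_less_mult_iff)
    have "N > 0" using True by (rule le_less_trans[OF zero_le_power2])
    have "f\<^sup>2 * g\<^sup>2 < N * N" using True \<open>N > g\<^sup>2\<close> by (intro mult_strict_mono') auto
    then have "(f * g)\<^sup>2 < N\<^sup>2" by (simp add: power2_eq_square mult_ac)
    then have "V > 0" using \<open>N > 0\<close> by (simp add: V_def power2_less_imp_less)
    then show ?thesis using w True by (simp add: d_def)
  next
    case False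
    then have f: "N < f\<^sup>2" and g: "N < g\<^sup>2" using same by (auto simp: zero_less_mult_iff)
    \<comment> \<open>For N >= 0 the region f^2 > N has two components, and f g > 0 keeps f and g in
      the same one. For N < 0 it is connected and the norm identity \<open>VU\<close> bounds
      V.\<close>
    have "V < w"
    proof (cases "N \<ge> 0")
      case True
      have "N * N < f\<^sup>2 * g\<^sup>2" using f g True by (intro mult_strict_mono') auto
      then have "N\<^sup>2 < (f * g)\<^sup>2" by (simp add: power2_eq_square mult_ac)
      then have "N < f * g" using pos[OF f True] by (simp add: power2_less_imp_less)
      then show ?thesis using w(1) by (simp add: V_def)
    next
      case False
      show ?thesis
      proof (cases "U = 0")
        case True
        then have "V = N - f\<^sup>2" by (simp add: V_def U_def power2_eq_square)
        then show ?thesis using f w(1) by simp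
      next
        case U: False
        have "N * U\<^sup>2 < 0" using False U by (simp add: mult_less_0_iff)
        then have "V\<^sup>2 < w\<^sup>2" using VU by simp
        then show ?thesis using w(1) by (simp add: power2_less_imp_less)
      qed
    qed
    then show ?thesis using False by (simp add: d_def)
  qed
  define E where "E = d * V + w"
  \<comment> \<open>The half-angle formula: (dV + w + dUZ)^2 = 2 (dV + w)(dV + dUZ), because NU^2 =
    V^2 - w^2.\<close>
  define b where "b = d * U / E"
  have E0: "E > 0" using E by (simp add: E_def)
  have "E\<^sup>2 - N * U\<^sup>2 = 2 * w * E"
  proof -
    have "E\<^sup>2 - N * U\<^sup>2 = d\<^sup>2 * V\<^sup>2 - N * U\<^sup>2 + w\<^sup>2 + 2 * d * V * w"
      by (simp add: E_def power2_eq_square algebra_simps)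
    also have "\<dots> = 2 * w\<^sup>2 + 2 * d * V * w" using VU d(1) by simp
    also have "\<dots> = 2 * w * E" by (simp add: E_def power2_eq_square algebra_simps)
    finally show ?thesis .
  qed
  then have NU: "N * U\<^sup>2 = E * (E - 2 * w)" by (simp add: power2_eq_square algebra_simps)
  have "b\<^sup>2 = U\<^sup>2 / E\<^sup>2" by (simp add: b_def power_divide power_mult_distrib d(1))
  then have Nb: "N * b\<^sup>2 = (E - 2 * w) / E"
    using NU E0 by (simp add: power2_eq_square)
  have 1: "N * b\<^sup>2 < 1" unfolding Nb using E0 w(1) by (simp add: field_simps)
  have 2: "1 + N * b\<^sup>2 = 2 * d * V / E" unfolding Nb using E0 by (simp add: E_def field_simps)
  have 3: "1 + N * b\<^sup>2 + 2 * b * f = 2 * (d * (N - f\<^sup>2)) / E"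
    unfolding 2 using E0 by (simp add: b_def V_def U_def power2_eq_square field_simps)
  have 4: "(1 + N * b\<^sup>2) * f + 2 * b * N = g * (1 + N * b\<^sup>2 + 2 * b * f)"
    unfolding 3 unfolding 2 using E0 by (simp add: b_def V_def U_def power2_eq_square field_simps)
  show thesis
    by (rule that[OF 1 _ 4]) (unfold 3, use d(2) E0 in simp)
qed

section \<open>The algebra generated by \<open>Z\<close> on the plane \<open>W\<close>\<close>

context config
begin

definition N :: real where "N = 1 - K\<^sup>2"

lemma p1_in_W: "p1 \<in> W" and p2_in_W: "p2 \<in> W"
  by (simp_all add: vec.span_base)

lemma Z_square: "x \<in> W \<Longrightarrow> Z (Z x) = of_real N *s x"
  by (simp add: Z_Z N_def)

lemma S_eq_Z: "S x = of_real K *s x - \<i> *s Z x"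
  by (simp add: Z_def vec_eq_iff algebra_simps)

lemma p2_notin: "p2 \<notin> vec.span {p1}" and p1_notin: "p1 \<notin> vec.span {p2}"
proof -
  have *: "h u u * h v v = h u v * h v u" if "u \<in> vec.span {v}" for u v
    using that unfolding mem_cspan1 by (auto simp: expand)
  show "p2 \<notin> vec.span {p1}" "p1 \<notin> vec.span {p2}"
    using *[of p2 p1] *[of p1 p2] gram by (auto simp: mult.commute)
qed

lemma p1_nz: "p1 \<noteq> 0" and p2_nz: "p2 \<noteq> 0"
  using p1 p2 by auto

definition k12 :: complex where "k12 = 2 * sin \<theta>2 * cis (- \<theta>1) * h p1 p2 / h p2 p2"

text \<open>Chosen so that \<open>p2\<close> is proportional to (Z - \<i>\<omega>) p1; unrelated to
  the cube root of unity \<open>omega\<close>.\<close>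

definition \<omega> :: complex where "\<omega> = cis (\<theta>2 - \<theta>1) - K"

lemma k12: "k12 \<noteq> 0"
  using sin2 p12 p2 by (simp add: k12_def)

lemma Z_p1': "Z p1 = (\<i> * \<omega>) *s p1 + k12 *s p2"
  by (simp add: Z_p1 k12_def \<omega>_def)

lemma Z_p1_notin: "Z p1 \<notin> vec.span {p1}"
proof
  assume "Z p1 \<in> vec.span {p1}"
  then obtain c where "(\<i> * \<omega>) *s p1 + k12 *s p2 = c *s p1 + 0 *s p2"
    unfolding mem_cspan1 Z_p1' by auto
  then show False using cspan_pair_unique[OF p1_nz p2_notin] k12 by blast
qed

lemma Z_p2_notin: "Z p2 \<notin> vec.span {p2}"
proof
  assume "Z p2 \<in> vec.span {p2}"
  then obtain c where "(- \<i> * (cis (\<theta>2 - \<theta>1) - K)) *s p2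
    + (2 * sin \<theta>1 * cis \<theta>2 * h p2 p1 / h p1 p1) *s p1 = c *s p2 + 0 *s p1"
    unfolding mem_cspan1 Z_p2 by auto
  then have "2 * sin \<theta>1 * cis \<theta>2 * h p2 p1 / h p1 p1 = 0"
    using cspan_pair_unique[OF p2_nz p1_notin] by blast
  then show False using sin1 p12 p1 conj_sym[of p2 p1] by simp
qed

definition \<zeta> :: "cvec \<Rightarrow> real" where "\<zeta> x = Re (h (Z x) x)"

lemma h_Z: "x \<in> W \<Longrightarrow> h (Z x) x = of_real (\<zeta> x)"
  and h_Z': "x \<in> W \<Longrightarrow> h x (Z x) = of_real (\<zeta> x)"
  and h_Z_Z: "x \<in> W \<Longrightarrow> h (Z x) (Z x) = of_real (N * Re (h x x))"
proof -
  assume x: "x \<in> W"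
  have eq: "h (Z x) x = h x (Z x)" by (rule Z_selfadjoint[OF x x])
  moreover have "Im (h x (Z x)) = Im (cnj (h (Z x) x))" by (subst conj_sym) (rule refl)
  ultimately show 1: "h (Z x) x = of_real (\<zeta> x)" by (simp add: complex_eq_iff \<zeta>_def)
  show "h x (Z x) = of_real (\<zeta> x)" using eq 1 by simp
  have "h (Z x) (Z x) = h x (Z (Z x))" by (rule Z_selfadjoint[OF x Z_in_W[OF x]])
  also have "\<dots> = of_real (N * Re (h x x))"
    unfolding Z_square[OF x] scale_right using norm_real[of x] by simp
  finally show "h (Z x) (Z x) = of_real (N * Re (h x x))" .
qed

text \<open>\<open>A2 a b + B2 a b Z\<close> is the product of \<open>a + b Z\<close> with its adjoint.\<close>

definition A2 :: "complex \<Rightarrow> complex \<Rightarrow> real" where "A2 a b = (cmod a)\<^sup>2 + N * (cmod b)\<^sup>2"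
definition B2 :: "complex \<Rightarrow> complex \<Rightarrow> real" where "B2 a b = 2 * Re (a * cnj b)"

lemma A2_alt: "A2 a b = (Re a)\<^sup>2 + (Im a)\<^sup>2 + N * ((Re b)\<^sup>2 + (Im b)\<^sup>2)"
  by (simp add: A2_def cmod_power2)

lemma norm_comb:
  assumes "x \<in> W"
  shows "Re (h (a *s x + b *s Z x) (a *s x + b *s Z x)) = A2 a b * Re (h x x) + B2 a b * \<zeta> x"
  and "\<zeta> (a *s x + b *s Z x) = A2 a b * \<zeta> x + B2 a b * N * Re (h x x)"
proof -
  define m where "m = Re (h x x)"
  have m: "h x x = of_real m" using norm_real m_def by simp
  note r = h_Z[OF assms] h_Z'[OF assms] h_Z_Z[OF assms, folded m_def] m
  have "h (a *s x + b *s Z x) (a *s x + b *s Z x) =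
      a * cnj a * m + b * cnj b * (N * m) + (a * cnj b + b * cnj a) * \<zeta> x"
    by (simp add: expand r algebra_simps)
  then show "Re (h (a *s x + b *s Z x) (a *s x + b *s Z x)) = A2 a b * Re (h x x) + B2 a b * \<zeta> x"
    unfolding m_def[symmetric] A2_alt B2_def by (simp add: power2_eq_square algebra_simps)
  have "Z (a *s x + b *s Z x) = (b * N) *s x + a *s Z x"
    by (simp add: Z_add Z_scale Z_square[OF assms])
  then have "h (Z (a *s x + b *s Z x)) (a *s x + b *s Z x) =
      a * cnj a * \<zeta> x + b * cnj b * (N * \<zeta> x) + (a * cnj b + b * cnj a) * (N * m)"
    by (simp add: expand r algebra_simps)
  then show "\<zeta> (a *s x + b *s Z x) = A2 a b * \<zeta> x + B2 a b * N * Re (h x x)"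
    unfolding m_def[symmetric] A2_alt B2_def \<zeta>_def[of "a *s x + b *s Z x"]
    by (simp add: power2_eq_square algebra_simps)
qed

text \<open>The norm is multiplicative, so the left side is |a^2 - N b^2|^2.\<close>

lemma A2_B2: "(A2 a b)\<^sup>2 - N * (B2 a b)\<^sup>2 \<ge> 0"
proof -
  have "(A2 a b)\<^sup>2 - N * (B2 a b)\<^sup>2 = (Re (a\<^sup>2 - N * b\<^sup>2))\<^sup>2 + (Im (a\<^sup>2 - N * b\<^sup>2))\<^sup>2"
    unfolding A2_alt B2_def by (simp add: power2_eq_square algebra_simps)
  then show ?thesis by simp
qed

lemma \<zeta>_p1: "\<zeta> p1 = Re (h p1 p1) * (2 * sin \<theta>2 * cos \<theta>1 * \<tau> - sin (\<theta>2 - \<theta>1))"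
proof -
  define m where "m = Re (h p1 p1)"
  have m: "h p1 p1 = of_real m" using norm_real m_def by simp
  have *: "h p1 p2 * h p2 p1 / h p2 p2 = of_real (m * \<tau>)"
    using p1 p2 \<tau>_eq m by (simp add: field_simps)
  have "h (Z p1) p1 = (\<i> * (cis (\<theta>2 - \<theta>1) - K)) * m
    + 2 * sin \<theta>2 * cis (- \<theta>1) * (h p1 p2 * h p2 p1 / h p2 p2)"
    by (simp add: Z_p1 expand m)
  then have "\<zeta> p1 = Re ((\<i> * (cis (\<theta>2 - \<theta>1) - K)) * m + 2 * sin \<theta>2 * cis (- \<theta>1) * of_real (m * \<tau>))"
    unfolding * \<zeta>_def by (rule arg_cong)
  then show ?thesis unfolding m_def[symmetric] by (simp add: algebra_simps)
qed

text \<open>This is the Gram determinant of \<open>p1\<close> and \<open>Z p1\<close>. It equals 4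
  sin(\<theta>2)^2 \<tau> (1 - \<tau>) times the square of \<open>h p1 p1\<close>.\<close>

lemma gram_Z_p1: "N * (Re (h p1 p1))\<^sup>2 - (\<zeta> p1)\<^sup>2 \<noteq> 0"
proof -
  define c where "c = cos (\<theta>2 - \<theta>1)"
  define s where "s = sin (\<theta>2 - \<theta>1)"
  have cs: "c\<^sup>2 + s\<^sup>2 = 1" "(cos \<theta>1)\<^sup>2 + (sin \<theta>1)\<^sup>2 = 1" by (simp_all add: c_def s_def)
  have s2: "sin \<theta>2 = c * sin \<theta>1 + s * cos \<theta>1"
    using sin_add[of "\<theta>2 - \<theta>1" \<theta>1] by (simp add: c_def s_def)
  have K: "K = c - 2 * sin \<theta>1 * sin \<theta>2 * \<tau>"
    using cos_minus[of "\<theta>2 - \<theta>1"] by (simp add: K_def c_def)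
  have "1 - (c - 2 * s1 * s2 * t)\<^sup>2 - (2 * s2 * c1 * t - s)\<^sup>2 = 1 - (c\<^sup>2 + s\<^sup>2)
     + 4 * s2 * t * (c * s1 + s * c1) - 4 * s2\<^sup>2 * t\<^sup>2 * (c1\<^sup>2 + s1\<^sup>2)" for s1 s2 c1 t :: real
    by (simp add: power2_eq_square algebra_simps)
  then have "N - (2 * sin \<theta>2 * cos \<theta>1 * \<tau> - s)\<^sup>2 = 1 - (c\<^sup>2 + s\<^sup>2)
     + 4 * sin \<theta>2 * \<tau> * (c * sin \<theta>1 + s * cos \<theta>1) - 4 * (sin \<theta>2)\<^sup>2 * \<tau>\<^sup>2 * ((cos \<theta>1)\<^sup>2 + (sin \<theta>1)\<^sup>2)"
    unfolding N_def K .
  also have "\<dots> = 4 * (sin \<theta>2)\<^sup>2 * (\<tau> * (1 - \<tau>))"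
    unfolding cs s2[symmetric] by (simp add: power2_eq_square algebra_simps)
  finally have "N - (2 * sin \<theta>2 * cos \<theta>1 * \<tau> - s)\<^sup>2 \<noteq> 0"
    using sin2 \<tau>_neq_0 \<tau>_neq_1 by simp
  moreover have "Re (h p1 p1) \<noteq> 0" using p1 norm_real[of p1] by auto
  moreover have "N * (Re (h p1 p1))\<^sup>2 - (\<zeta> p1)\<^sup>2 =
     (Re (h p1 p1))\<^sup>2 * (N - (2 * sin \<theta>2 * cos \<theta>1 * \<tau> - s)\<^sup>2)"
    unfolding \<zeta>_p1 s_def by (simp add: power2_eq_square algebra_simps)
  ultimately show ?thesis by simp
qed

text \<open>The operator a + bZ commutes with \<open>Z\<close> and has inverse (a - bZ)/(a^2 - N
  b^2), so if it mapped \<open>x\<close> to an eigenvector, \<open>x\<close> would be one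
  too.\<close>

lemma comb_not_eigen:
  assumes x: "x \<in> W" "Z x \<notin> vec.span {x}" and y: "y = of_real a *s x + of_real b *s Z x"
    and ab: "N * b\<^sup>2 < a\<^sup>2" and eig: "S y = \<nu> *s y"
  shows False
proof -
  define \<mu> where "\<mu> = \<i> * (\<nu> - K)"
  have Zy: "Z y = \<mu> *s y"
    unfolding Z_def eig \<mu>_def by (simp add: vec_eq_iff algebra_simps)
  define c :: complex where "c = of_real (a\<^sup>2 - N * b\<^sup>2)"
  have c: "c \<noteq> 0" using ab unfolding c_def of_real_eq_0_iff by simp
  have Zy': "Z y = of_real a *s Z x + of_real (b * N) *s x"
    unfolding y by (simp add: Z_add Z_scale Z_square[OF x(1)])
  have cx: "c *s x = of_real a *s y - of_real b *s Z y"
    unfolding Zy' unfolding y c_def by (simp add: vec_eq_iff power2_eq_square algebra_simps)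
  have "c *s Z x = of_real a *s Z y - of_real b *s Z (Z y)"
  proof -
    have "Z (u - v) = Z u - Z v" for u v using Z_add[of "u - v" v] by (simp add: algebra_simps)
    then show ?thesis unfolding Z_scale[symmetric] cx by (simp add: Z_scale)
  qed
  also have "\<dots> = \<mu> *s (of_real a *s y - of_real b *s Z y)"
    unfolding Zy Z_scale unfolding Zy by (simp add: vec_eq_iff algebra_simps)
  also have "\<dots> = c *s (\<mu> *s x)" unfolding cx[symmetric] by (simp add: mult.commute)
  finally have "c *s Z x = c *s (\<mu> *s x)" .
  then have "Z x = \<mu> *s x" using c by (metis vector_mul_lcancel)
  then show False using x(2) mem_cspan1 by blast
qed

end

section \<open>Isometries commuting with the product\<close>

lemma matrix_vector_mult_axis: "(A :: complex^'n^'m) *v axis k 1 = column k A"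
  by (simp add: matrix_vector_mult_def axis_def column_def vec_eq_iff if_distrib cong: if_cong)

context hermitian
begin

lemma nondegenerate:
  assumes "signature_ppm h" and c: "\<And>x. h x c = 0"
  shows "c = 0"
proof -
  obtain b1 b2 b3 where b: "vec.span {b1, b2, b3} = UNIV"
    and o: "h b1 b2 = 0" "h b1 b3 = 0" "h b2 b3 = 0"
    and n: "Re (h b1 b1) > 0" "Re (h b2 b2) > 0" "Re (h b3 b3) < 0"
    using assms(1) unfolding signature_ppm_def by blast
  have o': "h b2 b1 = 0" "h b3 b1 = 0" "h b3 b2 = 0"
    using o orthogonal_sym by blast+
  have "c \<in> vec.span {b1, b2, b3}" unfolding b by simp
  then obtain x where "c - x *s b1 \<in> vec.span {b2, b3}"
    unfolding vec.span_insert[of b1] by blast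
  then obtain y z where "c - x *s b1 = y *s b2 + z *s b3" unfolding mem_cspan2 by blast
  then have ceq: "c = x *s b1 + (y *s b2 + z *s b3)" by (simp add: algebra_simps)
  have "cnj x * h b1 b1 = 0" "cnj y * h b2 b2 = 0" "cnj z * h b3 b3 = 0"
    using c[of b1] c[of b2] c[of b3] unfolding ceq by (simp_all add: expand o o')
  then show ?thesis using n unfolding ceq by auto
qed

text \<open>A change of basis for the Gram matrix. An orthogonal basis shows that the Gram
  determinant is nonzero, and an isometry then has determinant of modulus one.\<close>

lemma gram_matrix_det:
  fixes A :: "complex^3^3"
  shows "det (\<chi> i j. h (A *v axis i 1) (A *v axis j 1)) =
    det A * cnj (det A) * det (\<chi> i j. h (axis i 1) (axis j 1) :: complex^3^3)"
proof -
  have x: "x = x$1 *s axis 1 1 + x$2 *s axis 2 1 + x$3 *s axis 3 1" for x :: cvec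
    by (simp add: vec_eq_iff forall_3 axis_def)
  have hxy: "h x y = (\<Sum>i\<in>UNIV. \<Sum>j\<in>UNIV. x$i * cnj (y$j) * h (axis i 1) (axis j 1))" for x y
    by (subst x[of x], subst x[of y]) (simp add: expand sum_3 algebra_simps)
  have g: "h (A *v axis i 1) (A *v axis j 1) =
      (\<Sum>k\<in>UNIV. \<Sum>l\<in>UNIV. A$k$i * cnj (A$l$j) * h (axis k 1) (axis l 1))" for i j
    unfolding matrix_vector_mult_axis by (subst hxy) (simp add: column_def)
  have "(\<chi> i j. h (A *v axis i 1) (A *v axis j 1)) =
    transpose A ** (\<chi> i j. h (axis i 1) (axis j 1)) ** (\<chi> i j. cnj (A$i$j))"
    unfolding g by (simp add: vec_eq_iff matrix_matrix_mult_def transpose_def sum_3 algebra_simps)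
  moreover have "det (\<chi> i j. cnj (A$i$j)) = cnj (det A)"
    by (simp add: det_3)
  ultimately show ?thesis by (simp add: det_mul det_transpose)
qed

lemma det_unitary:
  assumes sig: "signature_ppm h" and C: "\<And>x y. h (C *v x) (C *v y) = h x y"
  shows "cmod (det C) = 1"
proof -
  define H where "H = (\<chi> i j. h (axis i 1) (axis j 1) :: complex^3^3)"
  obtain b1 b2 b3 where o: "h b1 b2 = 0" "h b1 b3 = 0" "h b2 b3 = 0"
    and n: "Re (h b1 b1) > 0" "Re (h b2 b2) > 0" "Re (h b3 b3) < 0"
    using sig unfolding signature_ppm_def by blast
  have o': "h b2 b1 = 0" "h b3 b1 = 0" "h b3 b2 = 0"
    using o orthogonal_sym by blast+
  define B :: "complex^3^3" where "B = (\<chi> i j. if j = 1 then b1$i else if j = 2 then b2$i else b3$i)"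
  have col: "B *v axis 1 1 = b1" "B *v axis 2 1 = b2" "B *v axis 3 1 = b3"
    by (simp_all add: matrix_vector_mult_axis column_def B_def vec_eq_iff)
  have "det (\<chi> i j. h (B *v axis i 1) (B *v axis j 1)) = h b1 b1 * h b2 b2 * h b3 b3"
    by (simp add: det_3 col o o')
  moreover have "\<dots> \<noteq> 0" using n by auto
  ultimately have "det H \<noteq> 0" using gram_matrix_det[of B] unfolding H_def by auto
  moreover have "det H = det C * cnj (det C) * det H"
    using gram_matrix_det[of C] unfolding C H_def .
  ultimately have "det C * cnj (det C) = 1" by simp
  then have "complex_of_real ((cmod (det C))\<^sup>2) = 1" by (simp only: complex_norm_square)
  then have "(cmod (det C))\<^sup>2 = 1" by (simp only: of_real_eq_1_iff)
  then show ?thesis using norm_ge_zero[of "det C"] unfolding power2_eq_1_iff by linarith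
qed

end

lemma unit_cube_root:
  assumes "cmod d = 1" obtains u where "cmod u = 1" "u ^ 3 * d = 1"
proof -
  define t where "t = Arg d"
  have d: "d = cis t" using assms rcis_cmod_Arg[of d] by (simp add: t_def rcis_def)
  have "cis (- t / 3) ^ 3 = cis (- t)" by (subst Complex.DeMoivre) simp
  then have "cis (- t / 3) ^ 3 * d = 1" unfolding d by (simp only: cis_mult) simp
  then show thesis using that[of "cis (- t / 3)"] by simp
qed

context config
begin

text \<open>The polar vector of \<open>W\<close> has eigenvalue
  \<open>cis (\<theta>1 + \<theta>2)\<close>. On \<open>W\<close>, where S has determinant one, a
  unit eigenvalue has real part K, so the two cannot coincide.\<close>

lemma cos_sum_neq_K: "K \<noteq> cos (\<theta>1 + \<theta>2)"
proof -
  have "K - cos (\<theta>1 + \<theta>2) = 2 * sin \<theta>1 * sin \<theta>2 * (1 - \<tau>)"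
    by (simp add: K_def cos_add cos_diff algebra_simps)
  then show ?thesis using sin1 sin2 \<tau>_neq_1 by auto
qed

lemma orthogonal_W: "h p1 x = 0 \<Longrightarrow> h p2 x = 0 \<Longrightarrow> w \<in> W \<Longrightarrow> h w x = 0"
  unfolding mem_cspan2 by (auto simp: expand)

lemma W_nondegenerate:
  assumes "w \<in> W" "h w p1 = 0" "h w p2 = 0" shows "w = 0"
proof -
  obtain a b where w: "w = a *s p1 + b *s p2" using assms(1) by (rule W_cases)
  have e: "a * h p1 p1 + b * h p2 p1 = 0" "a * h p1 p2 + b * h p2 p2 = 0"
    using assms(2,3) unfolding w by (simp_all add: expand)
  define D where "D = h p1 p1 * h p2 p2 - h p1 p2 * h p2 p1"
  have D: "D \<noteq> 0" using gram by (simp add: D_def)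
  have "a * D = (a * h p1 p1 + b * h p2 p1) * h p2 p2 - (a * h p1 p2 + b * h p2 p2) * h p2 p1"
    "b * D = (a * h p1 p2 + b * h p2 p2) * h p1 p1 - (a * h p1 p1 + b * h p2 p1) * h p1 p2"
    by (simp_all add: D_def algebra_simps)
  then have "a = 0 \<and> b = 0" unfolding e using D by simp
  then show ?thesis by (simp add: w)
qed

lemma polar_vector:
  assumes "signature_ppm h"
  obtains c where "h c c \<noteq> 0" "\<And>w. w \<in> W \<Longrightarrow> h w c = 0" "\<And>x. x - (h x c / h c c) *s c \<in> W"
proof -
  have "W \<noteq> UNIV"
  proof
    assume "W = UNIV"
    then have "vec.dim (UNIV :: cvec set) \<le> card {p1, p2}"
      by (metis vec.dim_le_card finite.emptyI finite_insert top_greatest)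
    also have "\<dots> \<le> 2" by (simp add: card_insert_if)
    finally show False by (simp add: card_cart_basis)
  qed
  then obtain x where x: "x \<notin> W" by blast
  define D where "D = h p1 p1 * h p2 p2 - h p1 p2 * h p2 p1"
  have D: "D \<noteq> 0" using gram by (simp add: D_def)
  \<comment> \<open>Cramer's rule: the coefficients of the orthogonal projection of \<open>x\<close>
    to \<open>W\<close>.\<close>
  define a where "a = (h x p1 * h p2 p2 - h x p2 * h p2 p1) / D"
  define b where "b = (h p1 p1 * h x p2 - h p1 p2 * h x p1) / D"
  define c where "c = x - (a *s p1 + b *s p2)"
  have c_notin: "c \<notin> W"
    using x in_W[of a b] vec.span_add[of c _ "a *s p1 + b *s p2"] by (auto simp: c_def)
  have "a * h p1 p1 + b * h p2 p1 = h x p1 * D / D" "a * h p1 p2 + b * h p2 p2 = h x p2 * D / D"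
    by (simp_all add: a_def b_def D_def add_divide_distrib[symmetric] algebra_simps)
  then have "h c p1 = 0" "h c p2 = 0"
    using D by (simp_all add: c_def expand)
  then have c': "h p1 c = 0" "h p2 c = 0" using orthogonal_sym by blast+
  have orth: "h w c = 0" if "w \<in> W" for w using orthogonal_W[OF c' that] .
  have ind: "vec.independent {c, p1, p2}"
  proof -
    have "vec.independent {p2}" using p2_nz vec.dependent_single by blast
    then have "vec.independent {p1, p2}"
      using p1_notin vec.independent_insertI by blast
    then show ?thesis using c_notin vec.independent_insertI by blast
  qed
  have card: "card {c, p1, p2} = 3"
  proof -
    have "p1 \<noteq> p2" using p2_notin by (auto simp: vec.span_base)
    moreover have "c \<noteq> p1" "c \<noteq> p2" using c_notin p1_in_W p2_in_W by auto
    ultimately show ?thesis by simp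
  qed
  have "UNIV \<subseteq> vec.span {c, p1, p2}"
    by (rule vec.card_ge_dim_independent[OF _ ind]) (simp_all add: card card_cart_basis)
  have dec: "\<exists>k. x - k *s c \<in> W" for x
    using \<open>UNIV \<subseteq> vec.span {c, p1, p2}\<close> unfolding vec.span_insert[of c] by blast
  have cc: "h c c \<noteq> 0"
  proof
    assume c0: "h c c = 0"
    have "h y c = 0" for y
    proof -
      obtain k where "y - k *s c \<in> W" using dec by blast
      from orth[OF this] show ?thesis by (simp add: expand c0)
    qed
    then have "c = 0" by (rule nondegenerate[OF assms])
    then show False using c_notin vec.span_zero by blast
  qed
  have "y - (h y c / h c c) *s c \<in> W" for y
  proof -
    obtain k where k: "y - k *s c \<in> W" using dec by blast
    from orth[OF this] have "h y c = k * h c c" by (simp add: expand)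
    then show ?thesis using k cc by simp
  qed
  with cc orth show thesis by (rule that)
qed

text \<open>The hypotheses say that a + bZ times its adjoint is 1 on \<open>W\<close>. Acting by the
  identity on the polar vector extends it to an isometry commuting with S, and a unit scalar brings
  the determinant to one.\<close>

lemma unitary_extension:
  assumes sig: "signature_ppm h" and ab: "A2 a b = 1" "B2 a b = 0"
  obtains C u where "C \<in> SU21 h" "u \<noteq> 0" "\<And>w. w \<in> W \<Longrightarrow> C *v w = u *s (a *s w + b *s Z w)"
    "\<And>x. C *v S x = S (C *v x)"
proof -
  obtain c where c: "h c c \<noteq> 0" and orth: "\<And>w. w \<in> W \<Longrightarrow> h w c = 0"
    and proj: "\<And>x. x - (h x c / h c c) *s c \<in> W" by (rule polar_vector[OF sig]) blast
  define k where "k x = h x c / h c c" for x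
  define P where "P x = x - k x *s c" for x
  have P: "P x \<in> W" for x using proj by (simp add: P_def k_def)
  have k_lin: "k (x + y) = k x + k y" "k (r *s x) = r * k x" for x y r
    by (simp_all add: k_def expand add_divide_distrib)
  have P_lin: "P (x + y) = P x + P y" "P (r *s x) = r *s P x" for x y r
    by (simp_all add: P_def k_lin vec_eq_iff algebra_simps)
  define T where "T w = a *s w + b *s Z w" for w
  have T_lin: "T (x + y) = T x + T y" "T (r *s x) = r *s T x" for x y r
    by (simp_all add: T_def Z_add Z_scale vec_eq_iff algebra_simps)
  have T_W: "T w \<in> W" if "w \<in> W" for w
    unfolding T_def by (intro vec.span_add vec.span_scale Z_in_W that)
  have T_h: "h (T v) (T w) = h v w" if v: "v \<in> W" and w: "w \<in> W" for v w
  proof -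
    have e: "h (Z v) (Z w) = N * h v w"
      using Z_selfadjoint[OF v Z_in_W[OF w]] Z_square[OF w] by (simp add: expand)
    have A: "of_real (A2 a b) = a * cnj a + N * (b * cnj b)"
      unfolding A2_def by (simp only: of_real_add of_real_mult complex_norm_square)
    have B: "of_real (B2 a b) = a * cnj b + b * cnj a"
      unfolding B2_def by (simp add: complex_eq_iff)
    have "h (T v) (T w) = of_real (A2 a b) * h v w + of_real (B2 a b) * h v (Z w)"
      unfolding A B T_def by (simp add: expand e Z_selfadjoint[OF v w] algebra_simps)
    then show ?thesis using ab by simp
  qed
  define f where "f x = T (P x) + k x *s c" for x
  have lin: "Vector_Spaces.linear (*s) (*s) f"
    unfolding Vector_Spaces.linear_iff by (simp add: vec.vector_space_axioms f_def P_lin T_lin k_lin vec_eq_iff algebra_simps)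
  have cW: "h c w = 0" if "w \<in> W" for w using orth[OF that] orthogonal_sym by blast
  have f_h: "h (f x) (f y) = h x y" for x y
  proof -
    have "h (f x) (f y) = h (P x) (P y) + k x * cnj (k y) * h c c"
      using T_h[OF P P] orth[OF T_W[OF P]] cW[OF T_W[OF P]] by (simp add: f_def expand)
    also have "\<dots> = h (P x + k x *s c) (P y + k y *s c)"
      using orth[OF P] cW[OF P] by (simp add: expand)
    finally show ?thesis by (simp add: P_def)
  qed
  define M where "M = matrix f"
  have M: "M *v x = f x" for x unfolding M_def by (rule matrix_works[OF lin])
  have "cmod (det M) = 1" by (rule det_unitary[OF sig]) (simp add: M f_h)
  then obtain u where u: "cmod u = 1" "u ^ 3 * det M = 1" by (rule unit_cube_root)
  define C where "C = (\<chi> i. u *s (M $ i))"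
  have C: "C *v x = u *s f x" for x
    unfolding M[symmetric] by (simp add: C_def matrix_vector_mult_def vec_eq_iff sum_distrib_left mult_ac)
  have "det C = u ^ 3 * det M" by (simp add: C_def det_3 power3_eq_cube algebra_simps)
  moreover have "h (C *v x) (C *v y) = h x y" for x y
  proof -
    have "u * cnj u = 1" using complex_norm_square[of u] u(1) by simp
    moreover have "h (C *v x) (C *v y) = (u * cnj u) * h x y" by (simp add: C expand f_h)
    ultimately show ?thesis by simp
  qed
  ultimately have SU: "C \<in> SU21 h" using u(2) by (simp add: SU21_def)
  have f_W: "f w = a *s w + b *s Z w" if "w \<in> W" for w
    using orth[OF that] by (simp add: f_def P_def k_def T_def)
  have S_c: "S c = cis (\<theta>1 + \<theta>2) *s c"
    using cW[OF p1_in_W] cW[OF p2_in_W] by (simp add: S_def rot_orthogonal rot_scale cis_mult add.commute)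
  have S_W: "S w \<in> W" if "w \<in> W" for w
    unfolding S_eq_Z by (intro vec.span_diff vec.span_scale Z_in_W that)
  have ZS: "Z (S x) = S (Z x)" for x
    unfolding Z_def S_scale using S_add[of "S x - K *s x" "K *s x"]
    by (simp add: S_scale vec_eq_iff algebra_simps)
  have "f (S x) = S (f x)" for x
  proof -
    have Sx: "S x = S (P x) + (k x * cis (\<theta>1 + \<theta>2)) *s c"
      using S_add[of "P x" "k x *s c"] by (simp add: S_scale S_c P_def)
    have "k (S x) = k x * cis (\<theta>1 + \<theta>2)"
      unfolding Sx k_def using orth[OF S_W[OF P]] c by (simp add: expand k_def)
    then have "P (S x) = S (P x)" unfolding P_def[of "S x"] using Sx by simp
    then show ?thesis
      unfolding f_def using \<open>k (S x) = k x * cis (\<theta>1 + \<theta>2)\<close>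
      by (simp add: S_add S_scale S_c T_def ZS)
  qed
  then have "C *v S x = S (C *v x)" for x by (simp add: C S_scale)
  moreover have "u \<noteq> 0" using u(1) by auto
  ultimately show thesis using that[OF SU, of u] f_W C by simp
qed

text \<open>The bound N b^2 < 1 serves twice: it fixes the sign of the product of the two ends,
  which selects the arc, and it keeps each 1 + l b Z invertible, so that no point of the arc is an
  eigenvector.\<close>

lemma arc_avoids_fixed_points:
  assumes x: "x \<in> W" "Z x \<notin> vec.span {x}" and b: "N * b\<^sup>2 < 1"
    and sign: "Re (h x x) * Re (h (x + of_real b *s Z x) (x + of_real b *s Z x)) > 0"
    and R: "\<And>y. R y = k *s S y" and k: "k \<noteq> 0"
  shows "h x (x + of_real b *s Z x) \<noteq> 0"
    and "geod_arc h x (x + of_real b *s Z x) \<inter> fixed_points R = {}"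
proof -
  define q where "q = x + of_real b *s Z x"
  define m where "m = Re (h x x)"
  have m: "h x x = of_real m" using norm_real m_def by simp
  have mm: "m \<noteq> 0" using sign by (auto simp: m_def)
  have hxq: "h x q = of_real (m + b * \<zeta> x)"
    by (simp add: q_def expand h_Z'[OF x(1)] m)
  have "Re (h q q) = (1 + N * b\<^sup>2) * m + 2 * b * \<zeta> x"
    using norm_comb(1)[OF x(1), of 1 "of_real b"]
    by (simp add: q_def A2_def B2_def m_def)
  then have "2 * (m * (m + b * \<zeta> x)) = m * Re (h q q) + m\<^sup>2 * (1 - N * b\<^sup>2)"
    by (simp add: power2_eq_square algebra_simps)
  also have "\<dots> > 0" using sign b mm by (intro add_pos_pos) (simp_all add: q_def m_def)
  finally have pos: "m * (m + b * \<zeta> x) > 0" by simp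
  then have "m + b * \<zeta> x \<noteq> 0" by auto
  then show "h x (x + of_real b *s Z x) \<noteq> 0" using hxq unfolding q_def by (metis of_real_eq_0_iff)
  have "geod_arc h x q \<subseteq> {point (x + of_real (l * b) *s Z x) | l. 0 \<le> l \<and> l \<le> 1}"
    unfolding q_def
  proof (rule geod_arc_subset)
    show "h x x \<noteq> 0" using mm m by simp
    show "h x (Z x) \<in> \<real>" by (simp add: h_Z'[OF x(1)])
    show "0 < Re (h x x) * Re (h x (x + complex_of_real b *s Z x))"
      using pos hxq unfolding m_def q_def by simp
  qed
  moreover have "point (x + of_real (l * b) *s Z x) \<notin> fixed_points R" if l: "0 \<le> l" "l \<le> 1" for l
  proof
    define y where "y = x + of_real (l * b) *s Z x"
    assume "point (x + of_real (l * b) *s Z x) \<in> fixed_points R"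
    then obtain v \<mu> where v: "point v = point y" "v \<noteq> 0" "R v = \<mu> *s v"
      unfolding fixed_points_def y_def by auto
    obtain c where c: "c \<noteq> 0" "v = c *s y" using point_eqD[OF v(1,2)] .
    have "k *s (c *s S y) = \<mu> *s (c *s y)" using v(3) unfolding R c(2) S_scale .
    then have "(1 / (k * c)) *s (k *s (c *s S y)) = (1 / (k * c)) *s (\<mu> *s (c *s y))" by (rule arg_cong)
    then have eig: "S y = (\<mu> / k) *s y" using k c(1) by simp
    have "N * (l * b)\<^sup>2 < 1"
    proof (cases "N \<ge> 0")
      case True
      have "l\<^sup>2 * (N * b\<^sup>2) \<le> 1 * (N * b\<^sup>2)"
        using l True by (intro mult_right_mono) (auto simp: power_le_one)
      then show ?thesis using b by (simp add: power_mult_distrib mult_ac)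
    next
      case False
      then have "N * (l * b)\<^sup>2 \<le> 0" by (simp add: mult_nonpos_nonneg)
      then show ?thesis by simp
    qed
    then show False using comb_not_eigen[OF x _ _ eig, of 1 "l * b"] by (simp add: y_def)
  qed
  ultimately show "geod_arc h x (x + of_real b *s Z x) \<inter> fixed_points R = {}"
    unfolding q_def by blast
qed

lemma refl_product_eq:
  assumes "\<alpha>1 = cis (\<eta>1 + \<theta>1)" "1 / \<alpha>1\<^sup>2 = cis (\<eta>1 - \<theta>1)"
    and "\<alpha>2 = cis (\<eta>2 + \<theta>2)" "1 / \<alpha>2\<^sup>2 = cis (\<eta>2 - \<theta>2)"
  shows "refl_product h (p1, p2, \<alpha>1, \<alpha>2) x = cis (\<eta>1 + \<eta>2) *s S x"
  by (simp add: refl_map_cis[OF assms(1,2)] refl_map_cis[OF assms(3,4)] rot_scale S_def cis_mult add.commute)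

lemma valid_quadruple_config:
  assumes "\<alpha>1 \<in> parameters" "\<alpha>2 \<in> parameters"
  shows "valid_quadruple h (p1, p2, \<alpha>1, \<alpha>2)"
proof -
  have "point p1 \<noteq> point p2"
  proof
    assume "point p1 = point p2"
    then obtain c where "p1 = c *s p2" using p1_nz by (rule point_eqD)
    then show False using p1_notin mem_cspan1 by blast
  qed
  moreover have "sgn_point h p1 \<noteq> 0" "sgn_point h p2 \<noteq> 0"
  proof -
    have "Re (h p1 p1) \<noteq> 0" "Re (h p2 p2) \<noteq> 0"
      using p1 p2 Re_norm_nz by blast+
    then show "sgn_point h p1 \<noteq> 0" "sgn_point h p2 \<noteq> 0"
      by (simp_all add: sgn_point_def sgn_zero_iff)
  qed
  moreover have "noneuclidean h W"
    unfolding noneuclidean_def using W_nondegenerate p1_in_W p2_in_W by blast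
  ultimately show ?thesis using assms p12 by (simp add: line_space_def)
qed

text \<open>The spans of \<open>p1\<close>, \<open>Z p1\<close> and of \<open>p2\<close>,
  \<open>Z p2\<close> give geodesics because \<open>Z\<close> is self-adjoint, and the phases in
  \<open>Z_p1\<close> and \<open>Z_p2\<close> give the prescribed angles.\<close>

lemma f_bending:
  assumes \<alpha>1: "\<alpha>1 = cis (\<eta>1 + \<theta>1)" "1 / \<alpha>1\<^sup>2 = cis (\<eta>1 - \<theta>1)" "Arg2pi (primitive \<alpha>1 ^ 3) = \<theta>1"
    and \<alpha>2: "\<alpha>2 = cis (\<eta>2 + \<theta>2)" "1 / \<alpha>2\<^sup>2 = cis (\<eta>2 - \<theta>2)" "Arg2pi (primitive \<alpha>2 ^ 3) = \<theta>2"
    and b: "N * b1\<^sup>2 < 1" "N * b2\<^sup>2 < 1"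
    and q: "q1 = p1 + of_real b1 *s Z p1" "q2 = p2 + of_real b2 *s Z p2"
    and sgn1: "Re (h p1 p1) * Re (h q1 q1) > 0" and sgn2: "Re (h p2 p2) * Re (h q2 q2) > 0"
    and prod: "refl_product h (p1, p2, \<alpha>1, \<alpha>2) = refl_product h (q1, q2, \<beta>1, \<beta>2)"
    and sectors: "same_sector \<alpha>1 \<beta>1" "same_sector \<alpha>2 \<beta>2" "\<alpha>1 * \<alpha>2 = \<beta>1 * \<beta>2"
  shows "f_bending_relation h (p1, p2, \<alpha>1, \<alpha>2) (q1, q2, \<beta>1, \<beta>2)"
proof -
  define G where "G = projective (span {p1, h p1 p2 *s p2})"
  define G1 where "G1 = projective (span {p1, Z p1})"
  define G2 where "G2 = projective (span {p2, Z p2})"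
  define n where "n = (cmod (h p1 p2))\<^sup>2"
  have n: "h p1 p2 * h p2 p1 = of_real n" "h p2 p1 * h p1 p2 = of_real n" "n \<noteq> 0"
    using complex_norm_square[of "h p1 p2"] conj_sym[of p2 p1] p12 by (simp_all add: n_def)
  have p21: "h p2 p1 \<noteq> 0" using n by auto
  have m: "h p1 p1 = of_real (Re (h p1 p1))" "h p2 p2 = of_real (Re (h p2 p2))" by (rule norm_real)+
  have mr: "Re (h p1 p1) \<noteq> 0" "Re (h p2 p2) \<noteq> 0" using sgn1 sgn2 by auto
  have notin: "h p1 p2 *s p2 \<notin> vec.span {p1}" "h p2 p1 *s p1 \<notin> vec.span {p2}"
  proof -
    have "u \<in> vec.span {p}" if "c \<noteq> 0" "c *s u \<in> vec.span {p}" for c and u p :: cvec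
      using vec.span_scale[OF that(2), of "1 / c"] that(1) by simp
    then show "h p1 p2 *s p2 \<notin> vec.span {p1}" "h p2 p1 *s p1 \<notin> vec.span {p2}"
      using p2_notin p1_notin p12 p21 by blast+
  qed
  \<comment> \<open>The angle at \<open>p2\<close> needs \<open>G\<close> as a real span starting
    with \<open>p2\<close>. Multiplication by \<open>h p2 p1\<close> carries one real plane to the
    other.\<close>
  have G_alt: "G = projective (span {p2, h p2 p1 *s p1})"
    unfolding G_def
  proof (rule projective_scale[OF p21])
    fix x assume "x \<in> span {p1, h p1 p2 *s p2}"
    then obtain a b where x: "x = of_real a *s p1 + of_real b *s (h p1 p2 *s p2)"
      unfolding mem_rspan2 by blast
    have "h p2 p1 *s x = (of_real b * (h p1 p2 * h p2 p1)) *s p2 + of_real a *s (h p2 p1 *s p1)"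
      unfolding x by (simp add: vec_eq_iff algebra_simps)
    then have "h p2 p1 *s x = of_real (b * n) *s p2 + of_real a *s (h p2 p1 *s p1)"
      unfolding n by simp
    then show "h p2 p1 *s x \<in> span {p2, h p2 p1 *s p1}" unfolding mem_rspan2 by blast
  next
    fix x assume "x \<in> span {p2, h p2 p1 *s p1}"
    then obtain a b where x: "x = of_real a *s p2 + of_real b *s (h p2 p1 *s p1)"
      unfolding mem_rspan2 by blast
    define y where "y = of_real b *s p1 + of_real (a / n) *s (h p1 p2 *s p2)"
    have "h p2 p1 *s y = (of_real (a / n) * (h p2 p1 * h p1 p2)) *s p2 + of_real b *s (h p2 p1 *s p1)"
      unfolding y_def by (simp add: vec_eq_iff algebra_simps)
    then have "x = h p2 p1 *s y" unfolding n x using n(3) by simp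
    moreover have "y \<in> span {p1, h p1 p2 *s p2}" unfolding mem_rspan2 y_def by blast
    ultimately show "\<exists>y\<in>span {p1, h p1 p2 *s p2}. x = h p2 p1 *s y" by blast
  qed
  have geo: "geodesic h (projective W) G" "geodesic h (projective W) G1" "geodesic h (projective W) G2"
  proof -
    have "h p1 (h p1 p2 *s p2) \<in> \<real>"
      unfolding scale_right conj_sym[of p2 p1, symmetric] n by (rule Reals_of_real)
    then show "geodesic h (projective W) G" unfolding G_def
      by (intro geodesic_span p1 notin vec.subspace_span p1_in_W vec.span_scale p2_in_W)
    show "geodesic h (projective W) G1" unfolding G1_def
      by (intro geodesic_span p1 Z_p1_notin vec.subspace_span p1_in_W Z_in_W) (simp add: h_Z'[OF p1_in_W])
    show "geodesic h (projective W) G2" unfolding G2_def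
      by (intro geodesic_span p2 Z_p2_notin vec.subspace_span p2_in_W Z_in_W) (simp add: h_Z'[OF p2_in_W])
  qed
  have ang1: "geod_angle p1 G1 G = \<theta>1"
    unfolding G1_def G_def
  proof (rule geod_angle_eq[OF p1_nz Z_p1_notin])
    \<comment> \<open>The real factor left in \<open>k12\<close> once its phase is compared with
      that of \<open>h p1 p2\<close>.\<close>
    define k where "k = Re (h p2 p2) / (2 * sin \<theta>2)"
    show "k \<noteq> 0" using mr sin2 by (simp add: k_def)
    have "cis \<theta>1 * k * k12 = (cis \<theta>1 * cis (- \<theta>1)) * h p1 p2"
      unfolding k_def k12_def by (subst m(2)) (use mr sin2 in \<open>simp add: field_simps\<close>)
    then have "cis \<theta>1 * k * k12 = h p1 p2" by (simp add: cis_mult)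
    then show "h p1 p2 *s p2 = cis \<theta>1 *s (of_real k *s Z p1) + (- cis \<theta>1 * k * \<i> * \<omega>) *s p1"
      unfolding Z_p1' by (simp add: vec_eq_iff algebra_simps)
  qed (use \<theta>1 in auto)
  have ang2: "geod_angle p2 G G2 = \<theta>2"
    unfolding G2_def G_alt
  proof (rule geod_angle_eq[OF p2_nz notin(2)])
    define k where "k = 2 * sin \<theta>1 / Re (h p1 p1)"
    show "k \<noteq> 0" using mr sin1 by (simp add: k_def)
    have k: "2 * sin \<theta>1 * cis \<theta>2 * h p2 p1 / h p1 p1 = cis \<theta>2 * k * h p2 p1"
      unfolding k_def by (subst m(1)) (use mr in \<open>simp add: field_simps\<close>)
    show "Z p2 = cis \<theta>2 *s (of_real k *s (h p2 p1 *s p1)) + (- \<i> * (cis (\<theta>2 - \<theta>1) - K)) *s p2"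
      unfolding Z_p2 k by (simp add: vec_eq_iff algebra_simps)
  qed (use \<theta>2 in auto)
  have mem: "point x \<in> projective (span {x', u})" if "x = of_real a *s x' + of_real b *s u" "x \<noteq> 0" for x x' u a b
    using that unfolding projective_def by (intro imageI DiffI) (auto simp: mem_rspan2)
  have "q1 \<noteq> 0" "q2 \<noteq> 0" using sgn1 sgn2 by auto
  then have pts: "point p1 \<in> G" "point p1 \<in> G1" "point p2 \<in> G2" "point p2 \<in> G" "point q1 \<in> G1" "point q2 \<in> G2"
    unfolding G_alt G1_def G2_def using p1_nz p2_nz
    by - (unfold G_alt[symmetric] G_def, rule mem[of _ 1 _ 0], simp, simp,
      rule mem[of _ 1 _ 0], simp, simp, rule mem[of _ 1 _ 0], simp, simp,
      unfold G_def[symmetric] G_alt, rule mem[of _ 1 _ 0], simp, simp,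
      rule mem[of _ 1 _ b1], simp add: q, simp, rule mem[of _ 1 _ b2], simp add: q, simp)
  have "associated_geodesics h (p1, p2, \<alpha>1, \<alpha>2) G G1 G2"
    using geo pts ang1 ang2 \<alpha>1(3) \<alpha>2(3) by (simp add: line_space_def)
  moreover have "sgn_point h q1 = sgn_point h p1" "sgn_point h q2 = sgn_point h p2"
    using sgn1 sgn2 by (auto simp: sgn_point_def sgn_if zero_less_mult_iff)
  moreover note R = refl_product_eq[OF \<alpha>1(1,2) \<alpha>2(1,2)]
  have cis_nz: "cis (\<eta>1 + \<eta>2) \<noteq> 0" by (rule cis_neq_zero)
  note arc1 = arc_avoids_fixed_points[OF p1_in_W Z_p1_notin b(1) sgn1[unfolded q] R cis_nz]
  note arc2 = arc_avoids_fixed_points[OF p2_in_W Z_p2_notin b(2) sgn2[unfolded q] R cis_nz]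
  ultimately show ?thesis
    unfolding f_bending_relation.simps Let_def
    using pts prod sectors arc1[folded q] arc2[folded q] by blast
qed

section \<open>Recovering one center from the other\<close>

lemma W_basis_Z:
  assumes "x \<in> W" obtains a b where "x = a *s p1 + b *s Z p1"
proof -
  obtain a b where x: "x = a *s p1 + b *s p2" using assms by (rule W_cases)
  have "k12 *s p2 = Z p1 - (\<i> * \<omega>) *s p1" unfolding Z_p1' by simp
  then have "(1 / k12) *s (k12 *s p2) = (1 / k12) *s (Z p1 - (\<i> * \<omega>) *s p1)" by (rule arg_cong)
  then have p2: "p2 = (1 / k12) *s (Z p1 - (\<i> * \<omega>) *s p1)" using k12 by simp
  have "x = (a - b / k12 * \<i> * \<omega>) *s p1 + (b / k12) *s Z p1"
    unfolding x by (subst p2) (simp add: vec_eq_iff algebra_simps)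
  then show thesis by (rule that)
qed

text \<open>The left side is the product (Z - \<i>\<omega>)(Z + \<i>\<omega>). By
  \<open>cos_diff_K\<close> it is nonzero, so \<open>p1\<close> can be recovered from
  \<open>p2\<close>.\<close>

lemma N_\<omega>: "of_real N + \<omega>\<^sup>2 = 2 * cis (\<theta>2 - \<theta>1) * of_real (cos (\<theta>2 - \<theta>1) - K)"
proof -
  have "cis x ^ 2 + 1 = 2 * cis x * cos x" for x
  proof -
    have "2 * cis x * cos x = cis x * (cis x + cis (- x))" by (simp add: complex_eq_iff)
    then show ?thesis by (simp add: power2_eq_square distrib_left cis_mult)
  qed
  then show ?thesis
    unfolding N_def \<omega>_def by (simp add: power2_eq_square algebra_simps)
qed

lemma cos_diff_K: "cos (\<theta>2 - \<theta>1) - K = 2 * sin \<theta>1 * sin \<theta>2 * \<tau>"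
  using cos_minus[of "\<theta>2 - \<theta>1"] by (simp add: K_def)

lemma p1_from_p2: "(of_real N + \<omega>\<^sup>2) *s p1 = k12 *s (Z p2 + (\<i> * \<omega>) *s p2)"
proof -
  have k: "k12 *s p2 = Z p1 - (\<i> * \<omega>) *s p1" unfolding Z_p1' by simp
  have "k12 *s (Z p2 + (\<i> * \<omega>) *s p2) = Z (k12 *s p2) + (\<i> * \<omega>) *s (k12 *s p2)"
    by (simp add: Z_scale vec_eq_iff algebra_simps)
  also have "Z (k12 *s p2) = of_real N *s p1 - (\<i> * \<omega>) *s Z p1"
    unfolding k using Z_add[of "Z p1 - (\<i> * \<omega>) *s p1" "(\<i> * \<omega>) *s p1"]
    by (simp add: Z_square[OF p1_in_W] Z_scale algebra_simps)
  finally show ?thesis unfolding k by (simp add: vec_eq_iff power2_eq_square algebra_simps)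
qed

end

lemma double_half: "2 * (x / 2) = (x :: real)"
  by simp

lemma cis_plus_cis_minus: "cis t + cis (- t) = 2 * cos t"
  and cis_minus_cis_minus: "cis t - cis (- t) = 2 * \<i> * sin t"
  by (simp_all add: complex_eq_iff)

text \<open>Multiplicativity of the norm, with y as half the angle difference of a second pair with
  the same K: the left side is the norm of a multiple of (Z + \<i>\<omega>)(Z - \<i>\<omega>'), and
  \<open>N_\<omega>\<close> gives the norm of each factor.\<close>

lemma (in config) perturbed_half_angles:
  fixes y :: real
  defines "x \<equiv> (\<theta>2 - \<theta>1) / 2"
  shows "(cos (x + y) - K * cos (x - y))\<^sup>2 - N * (sin (y - x))\<^sup>2 =
    (cos (\<theta>2 - \<theta>1) - K) * (cos (2 * y) - K)"
proof -
  have s: "(sin (y - x))\<^sup>2 = 1 - (cos (x - y))\<^sup>2"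
    using sin_cos_squared_add[of "x - y"] sin_minus[of "x - y"] by (simp add: power2_eq_square algebra_simps)
  have c1: "2 * cos (x + y) * cos (x - y) = cos (2 * x) + cos (2 * y)"
    using cos_times_cos[of "x + y" "x - y"] by (simp add: algebra_simps)
  have "cos (2 * x) * cos (2 * y) = (cos (2 * (x - y)) + cos (2 * (x + y))) / 2"
    using cos_times_cos[of "2 * x" "2 * y"] by (simp add: algebra_simps)
  then have c2: "cos (2 * x) * cos (2 * y) = (cos (x + y))\<^sup>2 + (cos (x - y))\<^sup>2 - 1"
    unfolding cos_double_cos by simp
  have "(cos (x + y) - K * cos (x - y))\<^sup>2 - N * (sin (y - x))\<^sup>2 =
     ((cos (x + y))\<^sup>2 + (cos (x - y))\<^sup>2 - 1) - K * (2 * cos (x + y) * cos (x - y)) + K\<^sup>2"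
    unfolding s N_def by (simp add: power2_eq_square algebra_simps)
  also have "\<dots> = (cos (2 * x) - K) * (cos (2 * y) - K)"
    unfolding c1 c2[symmetric] by (simp add: power2_eq_square algebra_simps)
  also have "2 * x = \<theta>2 - \<theta>1" unfolding x_def by (rule double_half)
  finally show ?thesis .
qed

section \<open>Two pairs with the same product\<close>

locale pair = P: config h p1 p2 \<theta>1 \<theta>2 + Q: config h q1 q2 \<phi>1 \<phi>2
  for h p1 p2 \<theta>1 \<theta>2 q1 q2 \<phi>1 \<phi>2 +
  assumes sig: "signature_ppm h"
    and S_eq: "Q.S = P.S"
    and W_eq: "vec.span {q1, q2} = vec.span {p1, p2}"
    and sgn1: "Re (h p1 p1) * Re (h q1 q1) > 0"
    and sgn2: "Re (h p2 p2) * Re (h q2 q2) > 0"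
begin

lemma S'_eq: "Q.S' x = P.S' x"
  using Q.S'_S[of "P.S' x"] unfolding S_eq P.S_S' .

lemma K_eq: "Q.K = P.K"
proof -
  have "q1 \<in> vec.span {p1, p2}" using Q.p1_in_W W_eq by simp
  then have "of_real (2 * P.K) *s q1 = of_real (2 * Q.K) *s q1"
    using P.trace Q.trace_p1 S_eq S'_eq by simp
  then show ?thesis using Q.p1_nz by simp
qed

lemma Z_eq: "Q.Z = P.Z"
  by (rule ext) (simp add: P.Z_def Q.Z_def S_eq K_eq)

lemma N_eq: "Q.N = P.N"
  by (simp add: P.N_def Q.N_def K_eq)

lemma \<zeta>_eq: "Q.\<zeta> = P.\<zeta>"
  by (rule ext) (simp add: P.\<zeta>_def Q.\<zeta>_def Z_eq)

lemma q1_in_W: "q1 \<in> vec.span {p1, p2}"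
  using Q.p1_in_W W_eq by simp

lemma first_point:
  obtains b where "P.N * b\<^sup>2 < 1"
    "Re (h p1 p1) * Re (h (p1 + of_real b *s P.Z p1) (p1 + of_real b *s P.Z p1)) > 0"
    "P.\<zeta> (p1 + of_real b *s P.Z p1) * Re (h q1 q1) =
      P.\<zeta> q1 * Re (h (p1 + of_real b *s P.Z p1) (p1 + of_real b *s P.Z p1))"
proof -
  define m where "m = Re (h p1 p1)"
  define m' where "m' = Re (h q1 q1)"
  define z where "z = P.\<zeta> p1"
  define z' where "z' = P.\<zeta> q1"
  define f where "f = z / m"
  define g where "g = z' / m'"
  have mm: "m * m' > 0" "m \<noteq> 0" "m' \<noteq> 0" using sgn1 by (auto simp: m_def m'_def)
  have zf: "z = f * m" "z' = g * m'" using mm by (simp_all add: f_def g_def)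
  obtain a b where q1: "q1 = a *s p1 + b *s P.Z p1" using q1_in_W by (rule P.W_basis_Z)
  define A where "A = P.A2 a b"
  define B where "B = P.B2 a b"
  have m'_eq: "m' = A * m + B * z" and z'_eq: "z' = A * z + B * P.N * m"
    unfolding A_def B_def m_def m'_def z_def z'_def q1 by (rule P.norm_comb[OF P.p1_in_W])+
  have AB: "A\<^sup>2 - P.N * B\<^sup>2 \<ge> 0" unfolding A_def B_def by (rule P.A2_B2)
  have "P.N * m\<^sup>2 - z\<^sup>2 \<noteq> 0" unfolding m_def z_def by (rule P.gram_Z_p1)
  have g': "P.N * m'\<^sup>2 - z'\<^sup>2 \<noteq> 0"
    using Q.gram_Z_p1 unfolding N_eq \<zeta>_eq m'_def z'_def .
  have gg: "P.N * m'\<^sup>2 - z'\<^sup>2 = (A\<^sup>2 - P.N * B\<^sup>2) * (P.N * m\<^sup>2 - z\<^sup>2)"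
    unfolding m'_eq z'_eq by (simp add: power2_eq_square algebra_simps)
  with g' AB have AB': "A\<^sup>2 - P.N * B\<^sup>2 > 0" by (cases "A\<^sup>2 - P.N * B\<^sup>2 = 0") auto
  have "0 < (A\<^sup>2 - P.N * B\<^sup>2) * (P.N * m\<^sup>2 - z\<^sup>2)\<^sup>2"
    using AB' \<open>P.N * m\<^sup>2 - z\<^sup>2 \<noteq> 0\<close> by simp
  also have "\<dots> = (P.N * m\<^sup>2 - z\<^sup>2) * (P.N * m'\<^sup>2 - z'\<^sup>2)"
    unfolding gg by (simp add: power2_eq_square)
  also have "\<dots> = (m * m')\<^sup>2 * ((P.N - f\<^sup>2) * (P.N - g\<^sup>2))"
    unfolding zf by (simp add: power2_eq_square algebra_simps)
  finally have same: "(P.N - f\<^sup>2) * (P.N - g\<^sup>2) > 0"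
    using mm by (simp add: zero_less_mult_iff)
  \<comment> \<open>On an indefinite \<open>W\<close> with \<open>N \<ge> 0\<close>, the form \<open>\<langle>Zx,x\<rangle>\<close> is semidefinite.\<close>
  have pos: "f * g > 0" if fN: "P.N < f\<^sup>2" and N0: "P.N \<ge> 0"
  proof -
    have zN: "P.N * m\<^sup>2 < z\<^sup>2" unfolding zf using fN mm by (simp add: power_mult_distrib)
    have z2: "z\<^sup>2 > 0" using zN N0 by (meson le_less_trans mult_nonneg_nonneg zero_le_power2)
    have A0: "A \<ge> 0" unfolding A_def P.A2_def using N0 by simp
    \<comment> \<open>In z' z = A z^2 + B N m z the first term dominates, by A^2 > N B^2 and z^2 > N
      m^2; so z' and z have the same sign.\<close>
    have "(B * P.N * m)\<^sup>2 = (P.N * B\<^sup>2) * (P.N * m\<^sup>2)"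
      by (simp add: power2_eq_square algebra_simps)
    also have "\<dots> \<le> A\<^sup>2 * (P.N * m\<^sup>2)"
      using AB' N0 by (intro mult_right_mono) auto
    also have "\<dots> < A\<^sup>2 * z\<^sup>2"
    proof (rule mult_strict_left_mono[OF zN])
      have "P.N * B\<^sup>2 \<ge> 0" using N0 by simp
      then show "A\<^sup>2 > 0" using AB' by linarith
    qed
    finally have "(B * P.N * m)\<^sup>2 < (A * \<bar>z\<bar>)\<^sup>2" by (simp add: power_mult_distrib)
    then have "\<bar>B * P.N * m\<bar> < A * \<bar>z\<bar>"
      using A0 by (intro power2_less_imp_less[of "\<bar>B * P.N * m\<bar>"]) (simp_all)
    then have "\<bar>B * P.N * m\<bar> * \<bar>z\<bar> < A * \<bar>z\<bar> * \<bar>z\<bar>"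
      using z2 by (intro mult_strict_right_mono) auto
    then have "\<bar>B * P.N * m * z\<bar> < A * z * z" by (simp add: abs_mult mult.assoc)
    then have "z' * z > 0" unfolding z'_eq by (simp add: algebra_simps)
    then have "f * g * (m * m') > 0" unfolding zf by (simp add: mult_ac)
    then show ?thesis using mm(1) by (simp add: zero_less_mult_iff)
  qed
  obtain b where b: "P.N * b\<^sup>2 < 1" "1 + P.N * b\<^sup>2 + 2 * b * f > 0"
    "(1 + P.N * b\<^sup>2) * f + 2 * b * P.N = g * (1 + P.N * b\<^sup>2 + 2 * b * f)"
    using torus_step[OF same pos] by blast
  define v where "v = p1 + of_real b *s P.Z p1"
  have "P.A2 1 (of_real b) = 1 + P.N * b\<^sup>2" "P.B2 1 (of_real b) = 2 * b"
    by (simp_all add: P.A2_def P.B2_def)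
  then have v: "Re (h v v) = m * (1 + P.N * b\<^sup>2 + 2 * b * f)"
    "P.\<zeta> v = m * ((1 + P.N * b\<^sup>2) * f + 2 * b * P.N)"
    using P.norm_comb[OF P.p1_in_W, of 1 "of_real b"] unfolding v_def m_def[symmetric] z_def[symmetric] zf
    by (simp_all add: algebra_simps)
  show thesis
  proof (rule that[OF b(1), folded v_def m_def m'_def z'_def])
    have "m * Re (h v v) = m\<^sup>2 * (1 + P.N * b\<^sup>2 + 2 * b * f)"
      unfolding v by (simp only: power2_eq_square mult.assoc)
    then show "0 < m * Re (h v v)" using b(2) mm by simp
    show "P.\<zeta> v * m' = z' * Re (h v v)" unfolding v b(3) zf by (simp add: mult_ac)
  qed
qed

text \<open>Write q1 = (x + yZ) v with complex x, y. Equality of the quotients at v and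
  \<open>q1\<close> makes x + yZ times its adjoint a real scalar, so after division by a real r it
  is unitary.\<close>

lemma common_centralizer:
  assumes b: "P.N * b\<^sup>2 < 1" and v: "v = p1 + of_real b *s P.Z p1"
    and pos: "Re (h p1 p1) * Re (h v v) > 0" and \<zeta>: "P.\<zeta> v * Re (h q1 q1) = P.\<zeta> q1 * Re (h v v)"
  obtains C c where "C \<in> SU21 h" "c \<noteq> 0" "C *v v = c *s q1" "\<And>x. C *v P.S x = P.S (C *v x)"
proof -
  define m where "m = Re (h v v)"
  define m' where "m' = Re (h q1 q1)"
  define r where "r = sqrt (m' / m)"
  define g where "g = P.\<zeta> q1 / m'"
  have mm: "m * m' > 0" "m \<noteq> 0" "m' \<noteq> 0"
    using sgn1 pos unfolding m_def m'_def by (auto simp: zero_less_mult_iff)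
  then have "m' / m > 0" by (auto simp: zero_less_divide_iff zero_less_mult_iff)
  then have r: "r > 0" "r\<^sup>2 * m = m'" using mm by (simp_all add: r_def)
  have g: "P.\<zeta> q1 = g * m'" "P.\<zeta> v = g * m"
    using \<zeta> mm unfolding m_def[symmetric] m'_def[symmetric] g_def by (simp_all add: field_simps)
  have vW: "v \<in> vec.span {p1, p2}"
    unfolding v by (intro vec.span_add vec.span_scale P.Z_in_W P.p1_in_W)
  define D where "D = 1 - P.N * b\<^sup>2"
  have D: "of_real D \<noteq> (0 :: complex)" using b unfolding of_real_eq_0_iff by (simp add: D_def)
  have Zv: "P.Z v = P.Z p1 + of_real (b * P.N) *s p1"
    unfolding v P.Z_add P.Z_scale P.Z_square[OF P.p1_in_W] by simp
  have p1: "p1 = (1 / of_real D) *s (v - of_real b *s P.Z v)"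
  proof -
    have "v - of_real b *s P.Z v = of_real D *s p1"
      unfolding Zv unfolding v D_def by (simp add: vec_eq_iff power2_eq_square algebra_simps)
    then show ?thesis using D by simp
  qed
  have Zp1: "P.Z p1 = (1 / of_real D) *s (P.Z v - of_real (b * P.N) *s v)"
  proof -
    have "P.Z v - of_real (b * P.N) *s v = of_real D *s P.Z p1"
      unfolding Zv unfolding v D_def by (simp add: vec_eq_iff power2_eq_square algebra_simps)
    then show ?thesis using D by simp
  qed
  obtain a0 b0 where q1: "q1 = a0 *s p1 + b0 *s P.Z p1" using q1_in_W by (rule P.W_basis_Z)
  \<comment> \<open>x + yZ is (a0 + b0 Z)(1 + bZ)^-1, the inverse being (1 - bZ)/D.\<close>
  define x where "x = (a0 - b0 * of_real (b * P.N)) * (1 / of_real D)"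
  define y where "y = (b0 - a0 * of_real b) * (1 / of_real D)"
  have q1v: "q1 = x *s v + y *s P.Z v"
    unfolding q1 Zp1 unfolding x_def y_def
    by (subst p1) (simp add: vec_eq_iff algebra_simps del: mult_1_left times_divide_eq_left times_divide_eq_right)
  define A where "A = P.A2 x y"
  define B where "B = P.B2 x y"
  have n: "m' = A * m + B * (g * m)" "g * m' = A * (g * m) + B * P.N * m"
    using P.norm_comb[OF vW, of x y] unfolding q1v[symmetric] m_def[symmetric] m'_def[symmetric] g A_def B_def .
  have gN: "P.N - g\<^sup>2 \<noteq> 0"
  proof
    assume "P.N - g\<^sup>2 = 0"
    then have "P.N * m'\<^sup>2 - (g * m')\<^sup>2 = 0" by (simp add: power_mult_distrib)
    then show False using Q.gram_Z_p1 unfolding N_eq \<zeta>_eq g(1) m'_def by simp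
  qed
  \<comment> \<open>Eliminating A from the two equations \<open>n\<close>; the remaining factor is
    nonzero by the Gram determinant at \<open>q1\<close>.\<close>
  have "B * (P.N - g\<^sup>2) * m = (A * (g * m) + B * P.N * m) - g * (A * m + B * (g * m))"
    by (simp add: power2_eq_square algebra_simps)
  also have "\<dots> = 0" unfolding n[symmetric] by simp
  finally have B0: "B = 0" using gN mm by simp
  then have Ar: "A = r\<^sup>2" using n(1) r(2) mm by (metis add.right_neutral mult_right_cancel mult_zero_left)
  have "P.A2 (x / of_real r) (y / of_real r) = A / r\<^sup>2" "P.B2 (x / of_real r) (y / of_real r) = B / r\<^sup>2"
    using r(1) by (simp_all add: P.A2_def P.B2_def A_def B_def norm_divide power_divide add_divide_distrib power2_eq_square)
  then have "P.A2 (x / of_real r) (y / of_real r) = 1" "P.B2 (x / of_real r) (y / of_real r) = 0"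
    using Ar B0 r(1) by simp_all
  from P.unitary_extension[OF sig this]
  obtain C u where C: "C \<in> SU21 h" "u \<noteq> 0"
    "\<And>w. w \<in> vec.span {p1, p2} \<Longrightarrow> C *v w = u *s ((x / of_real r) *s w + (y / of_real r) *s P.Z w)"
    "\<And>x. C *v P.S x = P.S (C *v x)" by blast
  have "C *v v = (u / of_real r) *s q1"
    unfolding C(3)[OF vW] q1v by (simp add: vec_eq_iff algebra_simps)
  moreover have "u / of_real r \<noteq> 0" using C(2) r(1) by simp
  ultimately show thesis using that C(1,4) by blast
qed

text \<open>
  Since \<open>p2\<close> is a multiple of \<open>(Z - \<i> \<omega>) p1\<close>, and \<open>q2\<close> one of \<open>(Z - \<i> \<omega>') q1\<close> where \<open>\<omega>'\<close> is the
  \<open>\<omega>\<close> of the second pair, the second points are related by \<open>(Z - \<i> \<omega>') (Z + \<i> \<omega>) (1 + b Z)\<close>, which is a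
  real combination of \<open>1\<close> and \<open>Z\<close> up to a scalar.
\<close>

lemma second_point:
  assumes b: "P.N * b\<^sup>2 < 1" and v: "v = p1 + of_real b *s P.Z p1"
    and C: "C \<in> SU21 h" "c \<noteq> 0" "C *v v = c *s q1" "\<And>x. C *v P.S x = P.S (C *v x)"
  obtains b' d where "P.N * b'\<^sup>2 < 1" "d \<noteq> 0"
    "C *v (p2 + of_real b' *s P.Z p2) = d *s q2"
    "Re (h p2 p2) * Re (h (p2 + of_real b' *s P.Z p2) (p2 + of_real b' *s P.Z p2)) > 0"
proof -
  \<comment> \<open>Half angles allow the phase cis (x + y) to be factored out: (Z -
    \<i>\<omega>')(Z + \<i>\<omega>) = e (A + BZ) with real A and B.\<close>
  define x where "x = (\<theta>2 - \<theta>1) / 2"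
  define y where "y = (\<phi>2 - \<phi>1) / 2"
  define A where "A = cos (x + y) - P.K * cos (x - y)"
  define B where "B = sin (y - x)"
  define e where "e = 2 * cis (x + y)"
  have cis2: "cis (2 * x) = cis (x + y) * cis (x - y)" "cis (2 * y) = cis (x + y) * cis (- (x - y))"
    by (simp_all add: cis_mult)
  have \<omega>: "P.\<omega> = cis (x + y) * cis (x - y) - P.K" "Q.\<omega> = cis (x + y) * cis (- (x - y)) - P.K"
  proof -
    have "2 * x = \<theta>2 - \<theta>1" "2 * y = \<phi>2 - \<phi>1" unfolding x_def y_def by (rule double_half)+
    then show "P.\<omega> = cis (x + y) * cis (x - y) - P.K" "Q.\<omega> = cis (x + y) * cis (- (x - y)) - P.K"
      unfolding P.\<omega>_def Q.\<omega>_def K_eq cis2[symmetric] by simp_all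
  qed
  have eA: "of_real P.N + P.\<omega> * Q.\<omega> = e * A"
  proof -
    have 1: "cis (x + y) * cis (- (x + y)) = 1" "cis (x - y) * cis (- (x - y)) = 1"
      by (simp_all add: cis_mult)
    have "of_real P.N + P.\<omega> * Q.\<omega> = cis (x + y) * cis (- (x + y)) + cis (x + y) * cis (x + y) * (cis (x - y) * cis (- (x - y)))
       - P.K * cis (x + y) * (cis (x - y) + cis (- (x - y)))"
      unfolding \<omega> 1 unfolding P.N_def using 1(2)
      by (simp add: power2_eq_square algebra_simps)
    also have "\<dots> = cis (x + y) * ((cis (x + y) + cis (- (x + y))) - P.K * (cis (x - y) + cis (- (x - y))))"
      unfolding 1(2) by (simp add: algebra_simps)
    also have "cis (x + y) + cis (- (x + y)) = 2 * cos (x + y)" by (rule cis_plus_cis_minus)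
    also have "cis (x - y) + cis (- (x - y)) = 2 * cos (x - y)" by (rule cis_plus_cis_minus)
    finally show ?thesis by (simp add: e_def A_def algebra_simps)
  qed
  have eB: "\<i> * (P.\<omega> - Q.\<omega>) = e * B"
  proof -
    have "cis (x - y) - cis (- (x - y)) = - 2 * \<i> * sin (y - x)"
      using sin_minus[of "x - y"] unfolding cis_minus_cis_minus by simp
    moreover have "\<i> * (P.\<omega> - Q.\<omega>) = \<i> * cis (x + y) * (cis (x - y) - cis (- (x - y)))"
      unfolding \<omega> by (simp add: algebra_simps)
    ultimately have "\<i> * (P.\<omega> - Q.\<omega>) = \<i> * cis (x + y) * (- 2 * \<i> * sin (y - x))" by simp
    also have "\<dots> = e * B"
    proof -
      have "\<i> * c * (- 2 * \<i> * s) = 2 * c * s" for c s :: complex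
        by (simp add: complex_eq_iff)
      then show ?thesis unfolding e_def B_def .
    qed
    finally show ?thesis .
  qed
  \<comment> \<open>a2 + c2 Z is the product (A + BZ)(1 + bZ).\<close>
  define a2 where "a2 = A + b * B * P.N"
  define c2 where "c2 = B + b * A"
  define w where "w = of_real a2 *s p2 + of_real c2 *s P.Z p2"
  define n where "n = of_real P.N + P.\<omega>\<^sup>2"
  \<comment> \<open>Each tance has the sign of the product of the signatures of its two points, and
    these signatures agree for both pairs.\<close>
  have \<tau>\<tau>: "P.\<tau> * Q.\<tau> > 0"
  proof -
    have "h p1 p2 \<noteq> 0" "h q1 q2 \<noteq> 0" by (rule P.p12, rule Q.p12)
    then show ?thesis using sgn1 sgn2 unfolding P.\<tau>_def Q.\<tau>_def
      by (auto simp: zero_less_mult_iff zero_less_divide_iff divide_less_0_iff mult_less_0_iff)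
  qed
  have cosK: "cos (\<theta>2 - \<theta>1) - P.K = 2 * sin \<theta>1 * sin \<theta>2 * P.\<tau>"
    "cos (\<phi>2 - \<phi>1) - P.K = 2 * sin \<phi>1 * sin \<phi>2 * Q.\<tau>"
    using P.cos_diff_K Q.cos_diff_K K_eq by simp_all
  have n: "n \<noteq> 0"
    unfolding n_def P.N_\<omega> cosK using P.sin1 P.sin2 \<tau>\<tau> by auto
  have "A\<^sup>2 - P.N * B\<^sup>2 = (2 * sin \<theta>1 * sin \<theta>2 * P.\<tau>) * (2 * sin \<phi>1 * sin \<phi>2 * Q.\<tau>)"
    using P.perturbed_half_angles[of y] unfolding A_def B_def x_def[symmetric] cosK(1)
    unfolding cosK(2)[symmetric] y_def double_half .
  also have "\<dots> = 4 * (sin \<theta>1 * sin \<theta>2 * sin \<phi>1 * sin \<phi>2) * (P.\<tau> * Q.\<tau>)"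
    by (simp add: mult_ac)
  also have "\<dots> > 0" using \<tau>\<tau> P.sin1 P.sin2 Q.sin1 Q.sin2 by simp
  finally have AB: "A\<^sup>2 - P.N * B\<^sup>2 > 0" .
  have "a2\<^sup>2 - P.N * c2\<^sup>2 = (1 - P.N * b\<^sup>2) * (A\<^sup>2 - P.N * B\<^sup>2)"
    by (simp add: a2_def c2_def power2_eq_square algebra_simps)
  also have "\<dots> > 0" using b AB by simp
  finally have ac: "P.N * c2\<^sup>2 < a2\<^sup>2" by simp
  have Zw: "P.Z v - (\<i> * Q.\<omega>) *s v = (P.k12 * e / n) *s w"
  proof -
    have p1: "n *s p1 = P.k12 *s (P.Z p2 + (\<i> * P.\<omega>) *s p2)"
      unfolding n_def by (rule P.p1_from_p2)
    then have Zp1: "n *s P.Z p1 = P.k12 *s (of_real P.N *s p2 + (\<i> * P.\<omega>) *s P.Z p2)"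
      by (metis P.Z_add P.Z_scale P.Z_square P.p2_in_W)
    have "n *s (P.Z v - (\<i> * Q.\<omega>) *s v) =
      n *s P.Z p1 + of_real (b * P.N) *s (n *s p1) - (\<i> * Q.\<omega>) *s (n *s p1) - (\<i> * Q.\<omega> * b) *s (n *s P.Z p1)"
      unfolding v P.Z_add P.Z_scale P.Z_square[OF P.p1_in_W] by (simp add: vec_eq_iff algebra_simps)
    also have "\<dots> = P.k12 *s ((of_real P.N + P.\<omega> * Q.\<omega> + b * P.N * (\<i> * (P.\<omega> - Q.\<omega>))) *s p2
       + (\<i> * (P.\<omega> - Q.\<omega>) + b * (of_real P.N + P.\<omega> * Q.\<omega>)) *s P.Z p2)"
      unfolding p1 Zp1 by (simp add: vec_eq_iff algebra_simps)
    also have "\<dots> = (P.k12 * e) *s w"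
      unfolding eA eB w_def a2_def c2_def by (simp add: vec_eq_iff algebra_simps)
    finally have "(1 / n) *s (n *s (P.Z v - (\<i> * Q.\<omega>) *s v)) = (1 / n) *s ((P.k12 * e) *s w)" by simp
    then show ?thesis using n by (simp add: mult.commute)
  qed
  have lin: "C *v (x - y) = C *v x - C *v y" "C *v (k *s x) = k *s (C *v x)" for x y k
    by (simp_all add: matrix_vector_mult_diff_distrib vector_scalar_commute)
  have CZ: "C *v P.Z x = P.Z (C *v x)" for x
    unfolding P.Z_def lin C(4) by simp
  define l where "l = P.k12 * e / n"
  have l: "l \<noteq> 0" using n P.k12 by (simp add: l_def e_def)
  have "l *s (C *v w) = C *v (P.Z v - (\<i> * Q.\<omega>) *s v)" unfolding Zw l_def lin by simp
  also have "\<dots> = c *s (P.Z q1 - (\<i> * Q.\<omega>) *s q1)"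
    unfolding lin CZ C(3) P.Z_scale by (simp add: vec_eq_iff algebra_simps)
  also have "P.Z q1 - (\<i> * Q.\<omega>) *s q1 = Q.k12 *s q2"
    using Q.Z_p1' unfolding Z_eq by simp
  finally have "(1 / l) *s (l *s (C *v w)) = (1 / l) *s (c *s (Q.k12 *s q2))" by simp
  then have Cw: "C *v w = (c * Q.k12 / l) *s q2" using l by simp
  have "h w w = h (C *v w) (C *v w)" using C(1) by (simp add: SU21_def)
  also have "\<dots> = of_real ((cmod (c * Q.k12 / l))\<^sup>2) * h q2 q2"
    unfolding Cw by (rule P.norm_scale)
  finally have "Re (h w w) = (cmod (c * Q.k12 / l))\<^sup>2 * Re (h q2 q2)" by simp
  then have "Re (h p2 p2) * Re (h w w) = (cmod (c * Q.k12 / l))\<^sup>2 * (Re (h p2 p2) * Re (h q2 q2))" by simp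
  moreover have "c * Q.k12 / l \<noteq> 0" using C(2) Q.k12 l by simp
  ultimately have sgn: "Re (h p2 p2) * Re (h w w) > 0"
    using sgn2 by (simp only: mult_pos_pos zero_less_power2 norm_eq_zero not_False_eq_True)
  \<comment> \<open>If a2 = 0, then N < 0 and \<open>w\<close> is a real multiple of
    \<open>Z p2\<close>, whose sign is opposite to that of \<open>p2\<close>; but C maps
    \<open>w\<close> to a multiple of \<open>q2\<close>.\<close>
  have a2: "a2 \<noteq> 0"
  proof
    assume a0: "a2 = 0"
    then have "Re (h w w) = P.N * c2\<^sup>2 * Re (h p2 p2)"
      using P.norm_comb(1)[OF P.p2_in_W, of "of_real a2" "of_real c2"]
      by (simp add: w_def P.A2_def P.B2_def)
    moreover have "P.N * c2\<^sup>2 < 0" using ac a0 by simp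
    ultimately show False using sgn
      by (auto simp: zero_less_mult_iff mult_less_0_iff)
  qed
  define b' where "b' = c2 / a2"
  have w': "w = of_real a2 *s (p2 + of_real b' *s P.Z p2)"
    using a2 by (simp add: w_def b'_def vec.scale_right_distrib)
  show thesis
  proof (rule that)
    show "P.N * b'\<^sup>2 < 1" using ac a2 by (simp add: b'_def power_divide)
    have "of_real a2 *s (C *v (p2 + of_real b' *s P.Z p2)) = (c * Q.k12 / l) *s q2"
      using Cw unfolding w' lin .
    then have "(1 / of_real a2) *s (of_real a2 *s (C *v (p2 + of_real b' *s P.Z p2))) = (1 / of_real a2) *s ((c * Q.k12 / l) *s q2)"
      by (rule arg_cong)
    then show "C *v (p2 + of_real b' *s P.Z p2) = (c * Q.k12 / l / of_real a2) *s q2" using a2 by simp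
    show "c * Q.k12 / l / of_real a2 \<noteq> 0" using C(2) Q.k12 l a2 by simp
    have "Re (h w w) = a2\<^sup>2 * Re (h (p2 + of_real b' *s P.Z p2) (p2 + of_real b' *s P.Z p2))"
      unfolding w' P.norm_scale by simp
    with sgn have "0 < a2\<^sup>2 * (Re (h p2 p2) * Re (h (p2 + of_real b' *s P.Z p2) (p2 + of_real b' *s P.Z p2)))"
      by (simp only: mult.left_commute)
    then show "0 < Re (h p2 p2) * Re (h (p2 + of_real b' *s P.Z p2) (p2 + of_real b' *s P.Z p2))"
      using a2 by (simp only: zero_less_mult_iff zero_less_power2) auto
  qed
qed

end

section \<open>Parameters and angles\<close>

lemma cis_inj:
  assumes "cis x = cis y" "\<bar>x - y\<bar> < 2 * pi" shows "x = y"
proof -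
  have "cis (x - y) = 1" using assms(1) by (simp flip: cis_divide)
  then have "cos (x - y) = 1" by (simp add: complex_eq_iff)
  then have "cos (2 * ((x - y) / 2)) = 1" unfolding double_half .
  then have "sin ((x - y) / 2) = 0" unfolding cos_double_sin by simp
  moreover have "- pi < (x - y) / 2" "(x - y) / 2 < pi" using assms(2) by (auto simp: abs_less_iff)
  ultimately have "(x - y) / 2 = 0" using sin_eq_0_pi by blast
  then show ?thesis by simp
qed

lemma primitive_cis:
  assumes "0 < \<theta>" "\<theta> < pi" "\<alpha> ^ 3 = cis (2 * \<theta>)"
  shows "primitive \<alpha> = cis (\<theta> / 3)"
  unfolding primitive_def
proof (rule the_equality)
  have "cis (\<theta> / 3) ^ 6 = \<alpha> ^ 3" unfolding assms(3) Complex.DeMoivre by simp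
  moreover have "0 < \<theta> / 3" "\<theta> / 3 < pi / 3" using assms by simp_all
  ultimately show "cis (\<theta> / 3) \<in> {cis t | t. 0 < t \<and> t < pi / 3} \<and> cis (\<theta> / 3) ^ 6 = \<alpha> ^ 3"
    by blast
next
  fix a assume "a \<in> {cis t | t. 0 < t \<and> t < pi / 3} \<and> a ^ 6 = \<alpha> ^ 3"
  then obtain t where t: "a = cis t" "0 < t" "t < pi / 3" "cis t ^ 6 = cis (2 * \<theta>)"
    unfolding assms(3) by blast
  have "cis (6 * t) = cis (2 * \<theta>)" using t(4) unfolding Complex.DeMoivre by simp
  moreover have "\<bar>6 * t - 2 * \<theta>\<bar> < 2 * pi" using t assms by (simp add: abs_less_iff)
  ultimately have "6 * t = 2 * \<theta>" by (rule cis_inj)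
  then have "t = \<theta> / 3" by simp
  then show "a = cis (\<theta> / 3)" using t(1) by (simp only:)
qed

text \<open>\<kappa> is the argument of the common cube root of unity. The factor 3/2 stretches the
  sector to (0, pi), making \<theta> the argument of the cubed primitive.\<close>

lemma same_sector_cis:
  assumes "same_sector \<alpha> \<beta>"
  obtains \<kappa> \<theta> \<phi> where "cis (3 * \<kappa>) = 1" "0 < \<theta>" "\<theta> < pi" "0 < \<phi>" "\<phi> < pi"
    "\<alpha> = cis (\<kappa> + 2 * \<theta> / 3)" "\<beta> = cis (\<kappa> + 2 * \<phi> / 3)"
proof -
  obtain j t u where t: "0 < t" "t < 2 * pi / 3" "\<alpha> = omega ^ j * cis t"
    and u: "0 < u" "u < 2 * pi / 3" "\<beta> = omega ^ j * cis u"
    using assms unfolding same_sector_def by auto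
  define \<kappa> where "\<kappa> = real j * (2 * pi / 3)"
  have "omega ^ j = cis \<kappa>" unfolding omega_def Complex.DeMoivre \<kappa>_def ..
  then have "\<alpha> = cis (\<kappa> + 2 * (3 * t / 2) / 3)" "\<beta> = cis (\<kappa> + 2 * (3 * u / 2) / 3)"
    using t u by (simp_all add: cis_mult)
  moreover have "cis (3 * \<kappa>) = 1"
    unfolding \<kappa>_def using cis_multiple_2pi[of "real j"] by (simp add: mult_ac)
  ultimately show thesis using that[of \<kappa> "3 * t / 2" "3 * u / 2"] t u by simp
qed

text \<open>The formula for the inverse square holds only modulo \<open>cis (3 * \<kappa>)\<close>,
  which is 1.\<close>

lemma parameter_cis:
  assumes "cis (3 * \<kappa>) = 1" "0 < \<theta>" "\<theta> < pi" "\<alpha> = cis (\<kappa> + 2 * \<theta> / 3)"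
  defines "\<eta> \<equiv> \<kappa> - \<theta> / 3"
  shows "\<alpha> = cis (\<eta> + \<theta>)" "1 / \<alpha>\<^sup>2 = cis (\<eta> - \<theta>)" "Arg2pi (primitive \<alpha> ^ 3) = \<theta>"
proof -
  show "\<alpha> = cis (\<eta> + \<theta>)" unfolding assms(4) \<eta>_def by (rule arg_cong[of _ _ cis]) (simp add: field_simps)
  have "\<alpha>\<^sup>2 * cis (\<eta> - \<theta>) = cis (3 * \<kappa>)"
    unfolding assms(4) Complex.DeMoivre cis_mult \<eta>_def by (rule arg_cong[of _ _ cis]) (simp add: field_simps)
  moreover have "\<alpha> \<noteq> 0" unfolding assms(4) by (rule cis_neq_zero)
  ultimately show "1 / \<alpha>\<^sup>2 = cis (\<eta> - \<theta>)" unfolding assms(1) by (simp add: field_simps)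
  have "\<alpha> ^ 3 = cis (3 * \<kappa>) * cis (2 * \<theta>)"
    unfolding assms(4) Complex.DeMoivre cis_mult by (rule arg_cong[of _ _ cis]) (simp add: field_simps)
  then have "primitive \<alpha> = cis (\<theta> / 3)"
    using assms(1-3) by (intro primitive_cis) simp_all
  then have "primitive \<alpha> ^ 3 = cis \<theta>" by (simp add: Complex.DeMoivre)
  then show "Arg2pi (primitive \<alpha> ^ 3) = \<theta>"
    using assms(2,3) Arg2pi_unique[of 1 \<theta> "cis \<theta>"] by (simp add: cis_conv_exp mult.commute)
qed

section \<open>Eigenvectors and conjugates of the product\<close>

context config
begin

lemma S_orthogonal: "h c p1 = 0 \<Longrightarrow> h c p2 = 0 \<Longrightarrow> S c = cis (\<theta>1 + \<theta>2) *s c"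
  by (simp add: S_def rot_orthogonal rot_scale cis_mult add.commute)

lemma S_isometry: "h (S x) (S y) = h x y"
  by (simp add: S_adjoint S'_S)

lemma no_eigenvector_in_W:
  assumes "w \<in> W" "S w = cis (\<theta>1 + \<theta>2) *s w" shows "w = 0"
proof -
  have "w = S' (cis (\<theta>1 + \<theta>2) *s w)" using S'_S[of w] assms(2) by simp
  also have "\<dots> = cis (\<theta>1 + \<theta>2) *s S' w" by (rule S'_scale)
  finally have "cis (- (\<theta>1 + \<theta>2)) *s w = cis (- (\<theta>1 + \<theta>2)) *s (cis (\<theta>1 + \<theta>2) *s S' w)"
    by (rule arg_cong)
  then have "S' w = cis (- (\<theta>1 + \<theta>2)) *s w"
    unfolding vec.scale_scale cis_mult by simp
  then have "(cis (\<theta>1 + \<theta>2) + cis (- (\<theta>1 + \<theta>2))) *s w = (2 * K) *s w"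
    using trace[OF assms(1)] assms(2) by (simp add: vec.scale_left_distrib)
  then have "of_real (2 * cos (\<theta>1 + \<theta>2)) *s w = of_real (2 * K) *s w"
    unfolding cis_plus_cis_minus .
  then have "2 * cos (\<theta>1 + \<theta>2) = 2 * K \<or> w = 0"
    unfolding vector_mul_rcancel of_real_eq_iff .
  then show ?thesis using cos_sum_neq_K by simp
qed

text \<open>An isometry conjugates reflections, and scaling a center does not change its reflection.
  Thus the pair pulled back by C has product C^-1 S C = T; this yields the intermediate
  quadruple.\<close>

lemma config_transport:
  assumes C: "C \<in> SU21 h" and r1: "C *v r1 = c1 *s p1" "c1 \<noteq> 0" and r2: "C *v r2 = c2 *s p2" "c2 \<noteq> 0"
    and comm: "\<And>x. C *v T x = S (C *v x)"
  shows "config h r1 r2 \<theta>1 \<theta>2" and "signature_ppm h \<Longrightarrow> config.S h r1 r2 \<theta>1 \<theta>2 = T"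
proof -
  have Ch: "h x y = h (C *v x) (C *v y)" for x y using C by (simp add: SU21_def)
  show *: "config h r1 r2 \<theta>1 \<theta>2"
  proof
    show "h r1 r1 \<noteq> 0" "h r2 r2 \<noteq> 0" "h r1 r2 \<noteq> 0"
      unfolding Ch[of r1] Ch[of r2] r1 r2 using r1 r2 p1 p2 p12 by (simp_all add: expand)
    have "h r1 r1 * h r2 r2 - h r1 r2 * h r2 r1 =
      (c1 * cnj c1 * c2 * cnj c2) * (h p1 p1 * h p2 p2 - h p1 p2 * h p2 p1)"
      unfolding Ch[of r1] Ch[of r2] r1 r2 by (simp add: expand algebra_simps)
    moreover have "\<dots> \<noteq> 0" using r1 r2 gram by simp
    ultimately show "h r1 r1 * h r2 r2 \<noteq> h r1 r2 * h r2 r1" by auto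
  qed (use \<theta>1 \<theta>2 in auto)
  assume sig: "signature_ppm h"
  show "config.S h r1 r2 \<theta>1 \<theta>2 = T"
  proof
    fix x
    interpret R: config h r1 r2 \<theta>1 \<theta>2 by (rule *)
    have "C *v R.S x = C *v T x"
      unfolding R.S_def comm S_def rot_unitary[OF Ch[symmetric], symmetric] r1 r2
        rot_scale_center[OF r1(2)] rot_scale_center[OF r2(2)] ..
    then have z: "C *v (R.S x - T x) = 0" by (simp add: matrix_vector_mult_diff_distrib)
    have "h y (R.S x - T x) = 0" for y unfolding Ch[of y] z by simp
    then have "R.S x - T x = 0" by (rule nondegenerate[OF sig])
    then show "R.S x = T x" by simp
  qed
qed

end

section \<open>Length four relations\<close>

lemma config_of_points:
  assumes "hermitian_form h" "point p1 \<noteq> point p2" "sgn_point h p1 \<noteq> 0" "sgn_point h p2 \<noteq> 0" "h p1 p2 \<noteq> 0"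
    "noneuclidean h (line_space p1 p2)" "0 < \<theta>1" "\<theta>1 < pi" "0 < \<theta>2" "\<theta>2 < pi"
  shows "config h p1 p2 \<theta>1 \<theta>2"
proof -
  interpret hermitian h by standard (rule assms(1))
  have nz: "h p1 p1 \<noteq> 0" "h p2 p2 \<noteq> 0"
    using assms(3,4) by (auto simp: sgn_point_def sgn_zero_iff)
  have "h p1 p1 * h p2 p2 \<noteq> h p1 p2 * h p2 p1"
  proof
    assume eq: "h p1 p1 * h p2 p2 = h p1 p2 * h p2 p1"
    \<comment> \<open>A kernel vector of the singular Gram matrix.\<close>
    define x where "x = h p2 p2 *s p1 - h p1 p2 *s p2"
    have "h x p1 = 0" "h x p2 = 0" using eq by (simp_all add: x_def expand mult.commute)
    then have "h x (a *s p1 + b *s p2) = 0" for a b by (simp add: expand)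
    then have "\<forall>y\<in>line_space p1 p2. h x y = 0"
      unfolding line_space_def Ball_def mem_cspan2 by blast
    moreover have "x \<in> line_space p1 p2"
      unfolding x_def line_space_def by (intro vec.span_diff vec.span_scale vec.span_base) auto
    ultimately have "x = 0" using assms(6) unfolding noneuclidean_def by blast
    then have "h p2 p2 *s p1 = h p1 p2 *s p2" by (simp add: x_def)
    then have "point p1 = point p2" by (metis point_scale nz(2) assms(5))
    then show False using assms(2) by simp
  qed
  then show ?thesis using nz assms by unfold_locales
qed

text \<open>
  The polar vectors \<open>c\<close>, \<open>c'\<close> of the two lines are eigenvectors of the same isometry.  Since they
  are not orthogonal, their eigenvalues agree; and this eigenvalue is simple because
  \<^term>\<open>config.K\<close> is never \<open>cos (\<theta>1 + \<theta>2)\<close>.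
\<close>

lemma same_line:
  assumes P: "config h p1 p2 \<theta>1 \<theta>2" and Q: "config h q1 q2 \<phi>1 \<phi>2" and sig: "signature_ppm h"
    and R: "\<And>x. cis \<eta> *s config.S h p1 p2 \<theta>1 \<theta>2 x = cis \<eta>' *s config.S h q1 q2 \<phi>1 \<phi>2 x"
    and \<kappa>: "\<eta> + (\<theta>1 + \<theta>2) / 3 = \<eta>' + (\<phi>1 + \<phi>2) / 3"
    and orth: "\<not> orthogonal_lines h (line_space p1 p2) (line_space q1 q2)"
  shows "\<theta>1 + \<theta>2 = \<phi>1 + \<phi>2" "vec.span {q1, q2} = vec.span {p1, p2}"
    "config.S h q1 q2 \<phi>1 \<phi>2 = config.S h p1 p2 \<theta>1 \<theta>2"
proof -
  interpret P: config h p1 p2 \<theta>1 \<theta>2 by (rule P)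
  interpret Q: config h q1 q2 \<phi>1 \<phi>2 by (rule Q)
  obtain c where c: "h c c \<noteq> 0" "\<And>w. w \<in> P.W \<Longrightarrow> h w c = 0" "\<And>x. x - (h x c / h c c) *s c \<in> P.W"
    using P.polar_vector[OF sig] by blast
  obtain c' where c': "h c' c' \<noteq> 0" "\<And>w. w \<in> Q.W \<Longrightarrow> h w c' = 0" "\<And>x. x - (h x c' / h c' c') *s c' \<in> Q.W"
    using Q.polar_vector[OF sig] by blast
  have co: "h c w = 0" if "w \<in> P.W" for w using P.orthogonal_sym[OF c(2)[OF that]] .
  have co': "h c' w = 0" if "w \<in> Q.W" for w using P.orthogonal_sym[OF c'(2)[OF that]] .
  have c0: "c \<noteq> 0" using c(1) by auto
  have polar: "polar h P.W = point c"
  proof (intro set_eqI iffI)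
    fix x assume x: "x \<in> polar h P.W"
    define w where "w = x - (h x c / h c c) *s c"
    have w: "w \<in> P.W" unfolding w_def by (rule c(3))
    have "h w v = 0" if "v \<in> P.W" for v
      using x that co[OF that] unfolding polar_def w_def by (simp add: P.expand)
    then have "w = 0" using w P.p1_in_W P.p2_in_W P.W_nondegenerate by blast
    then have "x = (h x c / h c c) *s c" by (simp add: w_def)
    then show "x \<in> point c" unfolding point_def mem_cspan1 by blast
  next
    fix x assume "x \<in> point c"
    then show "x \<in> polar h P.W" unfolding point_def mem_cspan1 polar_def using co by (auto simp: P.expand)
  qed
  have "c \<notin> Q.W"
  proof
    assume "c \<in> Q.W"
    then have "point c \<in> projective Q.W" using c0 unfolding projective_def by blast
    then show False using orth polar unfolding orthogonal_lines_def line_space_def by simp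
  qed
  then have cc': "h c c' \<noteq> 0" using c'(3)[of c] by auto
  have Sc: "P.S c = cis (\<theta>1 + \<theta>2) *s c" by (intro P.S_orthogonal co P.p1_in_W P.p2_in_W)
  have Sc': "Q.S c' = cis (\<phi>1 + \<phi>2) *s c'" by (intro Q.S_orthogonal co' Q.p1_in_W Q.p2_in_W)
  have Pc': "P.S c' = (cis (- \<eta>) * cis (\<eta>' + (\<phi>1 + \<phi>2))) *s c'"
  proof -
    have "cis (- \<eta>) *s (cis \<eta> *s P.S c') = cis (- \<eta>) *s (cis \<eta>' *s (cis (\<phi>1 + \<phi>2) *s c'))"
      unfolding R Sc' ..
    then show ?thesis unfolding vec.scale_scale cis_mult by (simp add: add.assoc)
  qed
  \<comment> \<open>The phase between the eigenvalues at c and c'. By the hypothesis \<kappa> it is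
    2/3 of a difference smaller than 2 pi, so it can only be a trivial phase if it is 0.\<close>
  define d where "d = \<eta> + (\<theta>1 + \<theta>2) - (\<eta>' + (\<phi>1 + \<phi>2))"
  have "h c c' = h (P.S c) (P.S c')" by (rule P.S_isometry[symmetric])
  also have "\<dots> = cis (\<theta>1 + \<theta>2) * cnj (cis (- \<eta>) * cis (\<eta>' + (\<phi>1 + \<phi>2))) * h c c'"
    unfolding Sc Pc' by (simp add: P.expand)
  also have "cis (\<theta>1 + \<theta>2) * cnj (cis (- \<eta>) * cis (\<eta>' + (\<phi>1 + \<phi>2))) = cis d"
    by (simp add: d_def cis_mult cis_cnj algebra_simps)
  finally have "cis d = cis 0" using cc' by simp
  moreover have d: "d = 2 / 3 * ((\<theta>1 + \<theta>2) - (\<phi>1 + \<phi>2))" using \<kappa> by (simp add: d_def field_simps)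
  moreover have "\<bar>d - 0\<bar> < 2 * pi"
    unfolding d using P.\<theta>1 P.\<theta>2 Q.\<theta>1 Q.\<theta>2 by (simp add: abs_less_iff)
  ultimately have "d = 0" using cis_inj by blast
  then show s: "\<theta>1 + \<theta>2 = \<phi>1 + \<phi>2" using d by simp
  then have "\<eta> = \<eta>'" using \<kappa> by simp
  have "P.S x = Q.S x" for x
    using R[of x] unfolding \<open>\<eta> = \<eta>'\<close> by (simp add: vector_mul_lcancel)
  then show S: "Q.S = P.S" by auto
  \<comment> \<open>The component of c' in \<open>W\<close> is an eigenvector for an eigenvalue that
    does not occur there, so it vanishes.\<close>
  define k where "k = h c' c / h c c"
  define w where "w = c' - k *s c"
  have w: "w \<in> P.W" unfolding w_def k_def by (rule c(3))
  have "P.S c' = P.S w + k *s P.S c" unfolding w_def P.S_scale[symmetric] P.S_add[symmetric] by simp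
  then have "P.S w = cis (\<theta>1 + \<theta>2) *s w"
    using Sc' unfolding S s[symmetric] Sc w_def by (simp add: vec_eq_iff algebra_simps)
  then have "w = 0" using w P.no_eigenvector_in_W by blast
  then have c'k: "c' = k *s c" by (simp add: w_def)
  have k0: "k \<noteq> 0" using c'(1) c'k by auto
  have memP: "x \<in> P.W \<longleftrightarrow> h x c = 0" for x using c(2) c(3)[of x] by auto
  have memQ: "x \<in> Q.W \<longleftrightarrow> h x c' = 0" for x using c'(2) c'(3)[of x] by auto
  show "Q.W = P.W"
    unfolding set_eq_iff memP memQ c'k using k0 by (simp add: P.expand)
qed

theorem theorem6p11:
  fixes h :: "complex^3 \<Rightarrow> complex^3 \<Rightarrow> complex"
    and p1 p2 q1 q2 :: "complex^3"
    and \<alpha>1 \<alpha>2 \<beta>1 \<beta>2 :: complex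
  assumes "hermitian_form h" and "signature_ppm h"
    and "point p1 \<noteq> point p2" "sgn_point h p1 \<noteq> 0" "sgn_point h p2 \<noteq> 0" "h p1 p2 \<noteq> 0"
    and "point q1 \<noteq> point q2" "sgn_point h q1 \<noteq> 0" "sgn_point h q2 \<noteq> 0" "h q1 q2 \<noteq> 0"
    and "sgn_point h p1 = sgn_point h q1" "sgn_point h p2 = sgn_point h q2"
    and "\<alpha>1 \<in> parameters" "\<alpha>2 \<in> parameters" "\<beta>1 \<in> parameters" "\<beta>2 \<in> parameters"
    and "same_sector \<alpha>1 \<beta>1" "same_sector \<alpha>2 \<beta>2"
    and "noneuclidean h (line_space p1 p2)" "noneuclidean h (line_space q1 q2)"
    and "\<not> orthogonal_lines h (line_space p1 p2) (line_space q1 q2)"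
    and "refl_map h \<alpha>2 p2 \<circ> refl_map h \<alpha>1 p1 = refl_map h \<beta>2 q2 \<circ> refl_map h \<beta>1 q1"
  shows "(relation_step h)\<^sup>*\<^sup>* (p1, p2, \<alpha>1, \<alpha>2) (q1, q2, \<beta>1, \<beta>2)"
proof -
  obtain \<kappa>1 \<theta>1 \<phi>1 where 1: "cis (3 * \<kappa>1) = 1" "0 < \<theta>1" "\<theta>1 < pi" "0 < \<phi>1" "\<phi>1 < pi"
    "\<alpha>1 = cis (\<kappa>1 + 2 * \<theta>1 / 3)" "\<beta>1 = cis (\<kappa>1 + 2 * \<phi>1 / 3)"
    using \<open>same_sector \<alpha>1 \<beta>1\<close> by (rule same_sector_cis)
  obtain \<kappa>2 \<theta>2 \<phi>2 where 2: "cis (3 * \<kappa>2) = 1" "0 < \<theta>2" "\<theta>2 < pi" "0 < \<phi>2" "\<phi>2 < pi"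
    "\<alpha>2 = cis (\<kappa>2 + 2 * \<theta>2 / 3)" "\<beta>2 = cis (\<kappa>2 + 2 * \<phi>2 / 3)"
    using \<open>same_sector \<alpha>2 \<beta>2\<close> by (rule same_sector_cis)
  note \<alpha>1 = parameter_cis[OF 1(1-3,6)]
  note \<alpha>2 = parameter_cis[OF 2(1-3,6)]
  note \<beta>1 = parameter_cis[OF 1(1,4,5,7)]
  note \<beta>2 = parameter_cis[OF 2(1,4,5,7)]
  have P: "config h p1 p2 \<theta>1 \<theta>2"
    by (intro config_of_points assms 1 2)
  have Q: "config h q1 q2 \<phi>1 \<phi>2"
    by (intro config_of_points assms 1 2)
  interpret P: config h p1 p2 \<theta>1 \<theta>2 by (rule P)
  interpret Q: config h q1 q2 \<phi>1 \<phi>2 by (rule Q)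
  note RP = P.refl_product_eq[OF \<alpha>1(1,2) \<alpha>2(1,2)]
  note RQ = Q.refl_product_eq[OF \<beta>1(1,2) \<beta>2(1,2)]
  have prod: "refl_product h (p1, p2, \<alpha>1, \<alpha>2) = refl_product h (q1, q2, \<beta>1, \<beta>2)"
    using assms by simp
  have "cis (\<kappa>1 - \<theta>1 / 3 + (\<kappa>2 - \<theta>2 / 3)) *s P.S x = cis (\<kappa>1 - \<phi>1 / 3 + (\<kappa>2 - \<phi>2 / 3)) *s Q.S x" for x
    unfolding RP[symmetric] RQ[symmetric] prod ..
  \<comment> \<open>The remaining premise compares two sums that both equal \<kappa>1 +
    \<kappa>2.\<close>
  note line = same_line[OF P Q \<open>signature_ppm h\<close> this _ assms(21)]
  have s: "\<theta>1 + \<theta>2 = \<phi>1 + \<phi>2" and W_eq: "vec.span {q1, q2} = vec.span {p1, p2}" and S_eq: "Q.S = P.S"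
    by (rule line, simp add: field_simps)+
  have \<alpha>\<beta>: "\<alpha>1 * \<alpha>2 = \<beta>1 * \<beta>2"
  proof -
    have "\<kappa>1 + 2 * \<theta>1 / 3 + (\<kappa>2 + 2 * \<theta>2 / 3) = \<kappa>1 + 2 * \<phi>1 / 3 + (\<kappa>2 + 2 * \<phi>2 / 3)"
      using s by (simp add: field_simps)
    then show ?thesis unfolding 1(6,7) 2(6,7) cis_mult by (rule arg_cong)
  qed
  have sgn: "Re (h p1 p1) * Re (h q1 q1) > 0" "Re (h p2 p2) * Re (h q2 q2) > 0"
    using assms(4,5,11,12) by (auto simp: sgn_point_def sgn_if zero_less_mult_iff split: if_splits)
  interpret pair h p1 p2 \<theta>1 \<theta>2 q1 q2 \<phi>1 \<phi>2
    by unfold_locales (rule \<open>signature_ppm h\<close> S_eq W_eq sgn)+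
  obtain b1 where b1: "P.N * b1\<^sup>2 < 1"
    "Re (h p1 p1) * Re (h (p1 + of_real b1 *s P.Z p1) (p1 + of_real b1 *s P.Z p1)) > 0"
    "P.\<zeta> (p1 + of_real b1 *s P.Z p1) * Re (h q1 q1) =
      P.\<zeta> q1 * Re (h (p1 + of_real b1 *s P.Z p1) (p1 + of_real b1 *s P.Z p1))"
    by (rule first_point)
  define r1 where "r1 = p1 + of_real b1 *s P.Z p1"
  obtain C c1 where C: "C \<in> SU21 h" and c1: "c1 \<noteq> 0" "C *v r1 = c1 *s q1"
    and CS: "\<And>x. C *v P.S x = P.S (C *v x)"
    using common_centralizer[OF b1(1) r1_def b1(2,3)[folded r1_def]] by blast
  obtain b2 c2 where b2: "P.N * b2\<^sup>2 < 1" and c2: "c2 \<noteq> 0" "C *v (p2 + of_real b2 *s P.Z p2) = c2 *s q2"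
    and sgn2: "Re (h p2 p2) * Re (h (p2 + of_real b2 *s P.Z p2) (p2 + of_real b2 *s P.Z p2)) > 0"
    using second_point[OF b1(1) r1_def C c1 CS] by blast
  define r2 where "r2 = p2 + of_real b2 *s P.Z p2"
  note c2' = c2(2)[folded r2_def]
  have CS': "C *v P.S x = Q.S (C *v x)" for x using CS S_eq by simp
  note transport = Q.config_transport[OF C c1(2,1) c2' c2(1) CS']
  interpret R: config h r1 r2 \<phi>1 \<phi>2 by (rule transport)
  have RS: "R.S = P.S" by (rule transport(2)[OF \<open>signature_ppm h\<close>])
  note RR = R.refl_product_eq[OF \<beta>1(1,2) \<beta>2(1,2)]
  \<comment> \<open>The middle pair already carries the parameters \<beta>1, \<beta>2: the f-bending
    changes the parameters, and the bending only moves the points by C.\<close>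
  have prodR: "refl_product h (r1, r2, \<beta>1, \<beta>2) = refl_product h (q1, q2, \<beta>1, \<beta>2)"
    by (rule ext) (unfold RR RQ RS S_eq, rule refl)
  have valid: "valid_quadruple h (p1, p2, \<alpha>1, \<alpha>2)" "valid_quadruple h (r1, r2, \<beta>1, \<beta>2)"
    "valid_quadruple h (q1, q2, \<beta>1, \<beta>2)"
    by (intro P.valid_quadruple_config Q.valid_quadruple_config R.valid_quadruple_config assms)+
  have "f_bending_relation h (p1, p2, \<alpha>1, \<alpha>2) (r1, r2, \<beta>1, \<beta>2)"
    by (rule P.f_bending[OF \<alpha>1 \<alpha>2 b1(1) b2 r1_def r2_def b1(2)[folded r1_def] sgn2[folded r2_def]
        _ assms(17,18) \<alpha>\<beta>]) (unfold prod prodR, rule refl)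
  then have "relation_step h (p1, p2, \<alpha>1, \<alpha>2) (r1, r2, \<beta>1, \<beta>2)"
    unfolding relation_step_def using valid by blast
  moreover have "bending_relation h (r1, r2, \<beta>1, \<beta>2) (q1, q2, \<beta>1, \<beta>2)"
  proof -
    have "C *v (k *s x) = k *s (C *v x)" for k x by (simp add: vector_scalar_commute)
    then have "(*v) C \<circ> refl_product h (r1, r2, \<beta>1, \<beta>2) = refl_product h (r1, r2, \<beta>1, \<beta>2) \<circ> (*v) C"
      by (intro ext) (simp only: o_apply RR RS CS)
    moreover have "point q1 = point (C *v r1)" "point q2 = point (C *v r2)"
      unfolding c1 c2' using c1 c2 point_scale by simp_all
    ultimately show ?thesis
      unfolding bending_relation.simps Let_def using prodR C by blast
  qed
  then have "relation_step h (r1, r2, \<beta>1, \<beta>2) (q1, q2, \<beta>1, \<beta>2)"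
    unfolding relation_step_def using valid by blast
  ultimately show ?thesis by (meson rtranclp.rtrancl_refl rtranclp.rtrancl_into_rtrancl)
qed

end
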